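(* Let $G$ be a block-cycle graph. Then $Z(G)=P(G)$. Furthermore, for every covering of $V(G)$ by $P(G)$ vertex-disjoint induced paths, one can choose one end-point of each of these paths so that the chosen vertices form a minimum zero forcing set of $G$ and there is a chronological list of forces starting from this set whose maximal forcing chains are exactly these paths.
   Context: All graphs are finite, simple and undirected. Zero forcing: vertices are coloured black or white; if a black vertex $u$ has exactly one white neighbour $v$, then $v$ is recoloured black ("$u$ forces $v$"). A set $Z\subseteq V(G)$ is a zero forcing set if, starting with $Z$ black and all other vertices white, repeated application of this rule colours all vertices black; $Z(G)$ is the minimum size of a zero forcing set. Given a zero forcing set, recording the forces in the order performed gives a chronological list of forces; a forcing chain is a sequence $(v_1,\dots,v_k)$ with $v_i$ forcing $v_{i+1}$ for all $i$, and a maximal forcing chain is one not properly contained in another (a single vertex of the initial set that forces nothing is a maximal chain). The path cover number $P(G)$ is the minimum number of vertex-disjoint induced paths of $G$ covering all vertices of $G$. A graph is non-separable if it is connected and has no cut-vertex; a block is a maximal non-separable induced subgraph; a block-cycle graph is a graph in which every block is either an edge or a cycle. *)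

theory Defs
  imports "Graph_Theory.Digraph_Component" "HOL-Library.Sublist"
begin

text \<open>
  A finite simple undirected graph is an instance of the locale \<^locale>\<open>graph\<close>: a finite symmetric
  digraph without loops and parallel arcs, in which an undirected edge is a pair of opposite arcs.
\<close>

text \<open>In a symmetric digraph the strongly connected components are the connected components.\<close>

definition cut_vertex :: "('a, 'b) pre_digraph \<Rightarrow> 'a \<Rightarrow> bool" where
  "cut_vertex G v \<longleftrightarrow> v \<in> verts G \<and>
     card (pre_digraph.sccs_verts (pre_digraph.del_vert G v)) > card (pre_digraph.sccs_verts G)"

definition non_separable :: "('a, 'b) pre_digraph \<Rightarrow> bool" where
  "non_separable G \<longleftrightarrow> Digraph_Component.connected G \<and> \<not> (\<exists>v. cut_vertex G v)"

definition is_block :: "('a, 'b) pre_digraph \<Rightarrow> ('a, 'b) pre_digraph \<Rightarrow> bool" where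
  "is_block B G \<longleftrightarrow> induced_subgraph B G \<and> non_separable B \<and>
     \<not> (\<exists>B'. induced_subgraph B' G \<and> non_separable B' \<and> verts B \<subset> verts B')"

definition is_edge_graph :: "('a, 'b) pre_digraph \<Rightarrow> bool" where
  "is_edge_graph H \<longleftrightarrow>
     (\<exists>u v. u \<noteq> v \<and> verts H = {u, v} \<and> arcs_ends H = {(u, v), (v, u)})"

definition is_cycle_graph :: "('a, 'b) pre_digraph \<Rightarrow> bool" where
  "is_cycle_graph H \<longleftrightarrow>
     (\<exists>xs. distinct xs \<and> length xs \<ge> 3 \<and> verts H = set xs \<and>
        arcs_ends H = (\<Union>i<length xs. {(xs ! i, xs ! (Suc i mod length xs)),
                                        (xs ! (Suc i mod length xs), xs ! i)}))"

definition block_cycle_graph :: "('a, 'b) pre_digraph \<Rightarrow> bool" where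
  "block_cycle_graph G \<longleftrightarrow> (\<forall>B. is_block B G \<longrightarrow> is_edge_graph B \<or> is_cycle_graph B)"

text \<open>\<open>H\<close> is a path graph whose vertices, listed along the path, are \<open>xs\<close>.\<close>

definition path_order :: "('a, 'b) pre_digraph \<Rightarrow> 'a list \<Rightarrow> bool" where
  "path_order H xs \<longleftrightarrow> xs \<noteq> [] \<and> distinct xs \<and> verts H = set xs \<and>
     arcs_ends H = (\<Union>i<length xs - 1. {(xs ! i, xs ! Suc i), (xs ! Suc i, xs ! i)})"

definition induced_path :: "('a, 'b) pre_digraph \<Rightarrow> ('a, 'b) pre_digraph \<Rightarrow> bool" where
  "induced_path P G \<longleftrightarrow> induced_subgraph P G \<and> (\<exists>xs. path_order P xs)"

definition end_point :: "('a, 'b) pre_digraph \<Rightarrow> 'a \<Rightarrow> bool" where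
  "end_point P x \<longleftrightarrow> (\<exists>xs. path_order P xs \<and> (x = hd xs \<or> x = last xs))"

definition path_cover :: "('a, 'b) pre_digraph \<Rightarrow> ('a, 'b) pre_digraph set \<Rightarrow> bool" where
  "path_cover G \<P> \<longleftrightarrow> (\<forall>P\<in>\<P>. induced_path P G) \<and>
     pairwise (\<lambda>P Q. verts P \<inter> verts Q = {}) \<P> \<and> (\<Union>P\<in>\<P>. verts P) = verts G"

definition path_cover_number :: "('a, 'b) pre_digraph \<Rightarrow> nat" where
  "path_cover_number G = (LEAST k. \<exists>\<P>. path_cover G \<P> \<and> card \<P> = k)"

text \<open>\<open>B\<close> is the set of currently black vertices.\<close>

definition forces :: "('a, 'b) pre_digraph \<Rightarrow> 'a set \<Rightarrow> 'a \<Rightarrow> 'a \<Rightarrow> bool" where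
  "forces G B u v \<longleftrightarrow> u \<in> B \<and> {w \<in> verts G. u \<rightarrow>\<^bsub>G\<^esub> w} - B = {v}"

definition colour_change :: "('a, 'b) pre_digraph \<Rightarrow> 'a set \<Rightarrow> 'a set \<Rightarrow> bool" where
  "colour_change G B B' \<longleftrightarrow> (\<exists>u v. forces G B u v \<and> B' = insert v B)"

definition zero_forcing_set :: "('a, 'b) pre_digraph \<Rightarrow> 'a set \<Rightarrow> bool" where
  "zero_forcing_set G Z \<longleftrightarrow> Z \<subseteq> verts G \<and> (colour_change G)\<^sup>*\<^sup>* Z (verts G)"

definition zero_forcing_number :: "('a, 'b) pre_digraph \<Rightarrow> nat" where
  "zero_forcing_number G = (LEAST k. \<exists>Z. zero_forcing_set G Z \<and> card Z = k)"

definition minimum_zero_forcing_set :: "('a, 'b) pre_digraph \<Rightarrow> 'a set \<Rightarrow> bool" where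
  "minimum_zero_forcing_set G Z \<longleftrightarrow> zero_forcing_set G Z \<and> card Z = zero_forcing_number G"

text \<open>The forces, in the order performed, of a run from \<open>B\<close> that ends with every vertex black.\<close>

fun chronological_list :: "('a, 'b) pre_digraph \<Rightarrow> 'a set \<Rightarrow> ('a \<times> 'a) list \<Rightarrow> bool" where
  "chronological_list G B [] \<longleftrightarrow> B = verts G"
| "chronological_list G B ((u, v) # fs) \<longleftrightarrow>
     forces G B u v \<and> chronological_list G (insert v B) fs"

definition forcing_chain :: "('a, 'b) pre_digraph \<Rightarrow> ('a \<times> 'a) list \<Rightarrow> 'a list \<Rightarrow> bool" where
  "forcing_chain G fs vs \<longleftrightarrow>
     vs \<noteq> [] \<and> set vs \<subseteq> verts G \<and> successively (\<lambda>u v. (u, v) \<in> set fs) vs"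

definition maximal_forcing_chain :: "('a, 'b) pre_digraph \<Rightarrow> ('a \<times> 'a) list \<Rightarrow> 'a list \<Rightarrow> bool" where
  "maximal_forcing_chain G fs vs \<longleftrightarrow>
     forcing_chain G fs vs \<and> \<not> (\<exists>ws. forcing_chain G fs ws \<and> strict_sublist vs ws)"

text \<open>A chain is identified with the path that runs through the same vertices in chain order.\<close>

definition chains_are_paths ::
    "('a, 'b) pre_digraph \<Rightarrow> ('a \<times> 'a) list \<Rightarrow> ('a, 'b) pre_digraph set \<Rightarrow> bool" where
  "chains_are_paths G fs \<P> \<longleftrightarrow>
     (\<forall>vs. maximal_forcing_chain G fs vs \<longrightarrow> (\<exists>P\<in>\<P>. path_order P vs)) \<and>
     (\<forall>P\<in>\<P>. \<exists>vs. maximal_forcing_chain G fs vs \<and> path_order P vs)"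

end

theory Submission
  imports Defs
begin

text \<open>
  The forcing chains of any run are induced paths, so \<open>P(G) \<le> Z(G)\<close>. Conversely, \<^emph>\<open>every\<close> covering by
  disjoint induced paths, minimum or not, can be oriented so that forcing along the paths never gets
  stuck. A stuck position would be a cyclic pattern in which the last black vertex of each unfinished
  path has a white neighbour on the next one. Orientations without such a pattern are built by adding
  one path at a time and reversing components of the rest where needed. This works because two
  disjoint connected vertex sets of a block-cycle graph are joined by at most two edges: three edges
  would yield a biconnected induced subgraph with more edges than vertices, but every biconnected
  induced subgraph lies in an edge or a cycle.
\<close>

subsection \<open>Connected sets and edges between them\<close>

text \<open>The bound of two edges is a count. Connected sides with \<open>p\<close> and
  \<open>q\<close> vertices span at least \<open>p - 1\<close> and \<open>q - 1\<close> edges,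
  whereas a graph of maximum degree two on \<open>p + q\<close> vertices has at most
  \<open>p + q\<close> edges, which leaves two for the connection. The obstacle is that reversing
  some paths to avoid a deadlock with a new path may create deadlocks among the old ones. Two facts
  remove it. A cyclic pattern of waiting can be read backwards, so reversing all members of a family
  creates no deadlock in it. And paths in different components of the old union never wait for each
  other. Hence each component can be reversed as a whole, independently of the others. It remains to
  exclude a component that is in deadlock with the new path in both directions; this uses the edge
  bound twice. Since covers and zero forcing sets translate into each other with equal size, both
  numbers are the least element of the same set.\<close>

definition linked :: "('a \<Rightarrow> 'a \<Rightarrow> bool) \<Rightarrow> 'a set \<Rightarrow> 'a \<Rightarrow> 'a \<Rightarrow> bool" where
  "linked E S = (\<lambda>x y. E x y \<and> x \<in> S \<and> y \<in> S)\<^sup>*\<^sup>*"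

text \<open>The empty set counts as connected, so a single vertex meets the deletion condition of
  \<open>biconnected_degree\<close>.\<close>

definition conn :: "('a \<Rightarrow> 'a \<Rightarrow> bool) \<Rightarrow> 'a set \<Rightarrow> bool" where
  "conn E S \<longleftrightarrow> (\<forall>x\<in>S. \<forall>y\<in>S. linked E S x y)"

lemma linked_refl [simp]: "linked E S x x"
  by (simp add: linked_def)

lemma linked_trans: "linked E S x y \<Longrightarrow> linked E S y z \<Longrightarrow> linked E S x z"
  unfolding linked_def by (rule rtranclp_trans)

lemma linked_edge: "E x y \<Longrightarrow> x \<in> S \<Longrightarrow> y \<in> S \<Longrightarrow> linked E S x y"
  unfolding linked_def by blast

lemma linked_mono:
  assumes "linked E S x y" "S \<subseteq> T" shows "linked E T x y"
  using assms(1) unfolding linked_def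
  by (rule rtranclp_mono[THEN predicate2D, rotated]) (use assms(2) in blast)

lemma linked_sym: 
  assumes "symp E" "linked E S x y" shows "linked E S y x"
proof -
  have "symp (\<lambda>x y. E x y \<and> x \<in> S \<and> y \<in> S)"
    using assms(1) by (auto simp: symp_def)
  then show ?thesis
    using assms(2) unfolding linked_def by (meson symp_rtranclp sympD)
qed

lemma linked_mem: "linked E S x y \<Longrightarrow> x \<in> S \<Longrightarrow> y \<in> S"
  unfolding linked_def by (erule rtranclp_induct) auto

text \<open>Every vertex visited on the way is itself reachable inside \<open>S\<close>, so the walk
  never leaves the component of \<open>x\<close>.\<close>

lemma linked_component:
  assumes "linked E S x y" shows "linked E {z. linked E S x z} x y"
  using assms unfolding linked_def
proof (induction rule: rtranclp_induct)
  case base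
  then show ?case by simp
next
  case (step y z)
  then show ?case
    by (intro rtranclp.rtrancl_into_rtrancl[OF step.IH])
      (auto intro: rtranclp.rtrancl_into_rtrancl)
qed

lemma conn_component:
  assumes "symp E" shows "conn E {z. linked E S x z}"
  unfolding conn_def
  by (metis assms linked_component linked_sym linked_trans mem_Collect_eq)

lemma conn_Un_edge:
  assumes "symp E" "conn E A" "conn E B" "a \<in> A" "b \<in> B" "E a b"
  shows "conn E (A \<union> B)"
proof -
  have A: "linked E (A \<union> B) a y" if "y \<in> A" for y
    using assms that by (meson Un_upper1 conn_def linked_mono)
  have B: "linked E (A \<union> B) b y" if "y \<in> B" for y
    using assms that by (meson Un_upper2 conn_def linked_mono)
  have ab: "linked E (A \<union> B) a b"
    using assms by (intro linked_edge) auto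
  have "linked E (A \<union> B) a y" if "y \<in> A \<union> B" for y
    using that A B ab by (meson Un_iff linked_trans)
  then show ?thesis
    unfolding conn_def by (meson assms(1) linked_sym linked_trans)
qed

lemma conn_exit:
  assumes "conn E A" "B \<subseteq> A" "B \<noteq> {}" "B \<noteq> A"
  obtains x y where "x \<in> B" "y \<in> A - B" "E x y"
proof -
  obtain b c where bc: "b \<in> B" "c \<in> A - B" using assms by blast
  have "linked E A b c" using assms bc unfolding conn_def by blast
  then have "c \<in> B \<or> (\<exists>x\<in>B. \<exists>y\<in>A - B. E x y)"
    unfolding linked_def by (induction rule: rtranclp_induct) (use bc in auto)
  then show thesis using that bc by blast
qed

lemma conn_if_linked_to:
  assumes "symp E" "\<And>x. x \<in> S \<Longrightarrow> linked E S x v"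
  shows "conn E S"
  unfolding conn_def by (meson assms linked_sym linked_trans)

text \<open>The tree bound on the number of edges, with each edge counted as two ordered pairs and
  \<open>+ 2\<close> in place of a subtraction. A maximal nonempty subset of \<open>A\<close> that
  meets the bound must be \<open>A\<close>: an edge leaving it would add one vertex and at least two
  pairs.\<close>

lemma conn_many_pairs:
  assumes "finite A" "A \<noteq> {}" "conn E A" "symp E"
  shows "card {(x, y). x \<in> A \<and> y \<in> A \<and> E x y} + 2 \<ge> 2 * card A"
proof -
  let ?pairs = "\<lambda>B. {(x, y). x \<in> B \<and> y \<in> B \<and> E x y}"
  let ?good = "\<lambda>B. B \<subseteq> A \<and> B \<noteq> {} \<and> card (?pairs B) + 2 \<ge> 2 * card B"
  obtain a where a: "a \<in> A" using assms by blast
  have "{a} \<in> {B. ?good B}" using a by simp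
  moreover have "finite {B. ?good B}"
    by (rule finite_subset[of _ "Pow A"]) (use assms(1) in auto)
  ultimately have "\<exists>B\<in>{B. ?good B}. \<forall>C\<in>{B. ?good B}. B \<subseteq> C \<longrightarrow> B = C"
    by (intro finite_has_maximal) auto
  then obtain B where B: "?good B" and mx: "\<And>C. ?good C \<Longrightarrow> B \<subseteq> C \<Longrightarrow> B = C"
    by auto
  have "B = A"
  proof (rule ccontr)
    assume "B \<noteq> A"
    with B conn_exit[OF assms(3)] obtain x y where xy: "x \<in> B" "y \<in> A - B" "E x y" by metis
    have fB: "finite B" using B assms(1) finite_subset by blast
    have fp: "finite (?pairs C)" if "finite C" for C
      by (rule finite_subset[of _ "C \<times> C"]) (use that in auto)
    have "E y x" using xy assms(4) by (auto dest: sympD)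
    then have "?pairs B \<union> {(x, y), (y, x)} \<subseteq> ?pairs (insert y B)" using xy by auto
    then have "card (?pairs B \<union> {(x, y), (y, x)}) \<le> card (?pairs (insert y B))"
      by (rule card_mono[rotated]) (use fp[of "insert y B"] fB in simp)
    moreover have "card (?pairs B \<union> {(x, y), (y, x)}) = card (?pairs B) + card {(x, y), (y, x)}"
      by (rule card_Un_disjoint) (use fp[OF fB] xy in auto)
    moreover have "x \<noteq> y" using xy(1,2) by blast
    then have "card {(x, y), (y, x)} = 2" by simp
    ultimately have "?good (insert y B)" using B xy fB by auto
    then have "B = insert y B" by (rule mx) blast
    then show False using xy by blast
  qed
  then show ?thesis using B by blast
qed

section \<open>Minimal connected sets around given terminals\<close>

text \<open>An induced analogue of a Steiner tree with terminals \<open>T\<close>, minimal for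
  inclusion rather than for size.\<close>

definition min_conn :: "('a \<Rightarrow> 'a \<Rightarrow> bool) \<Rightarrow> 'a set \<Rightarrow> 'a set \<Rightarrow> bool" where
  "min_conn E T A \<longleftrightarrow> T \<subseteq> A \<and> conn E A \<and> (\<forall>B. T \<subseteq> B \<and> B \<subset> A \<longrightarrow> \<not> conn E B)"

lemma min_conn_exists:
  assumes "finite A" "T \<subseteq> A" "conn E A"
  obtains B where "B \<subseteq> A" "min_conn E T B"
proof -
  let ?S = "{B. T \<subseteq> B \<and> B \<subseteq> A \<and> conn E B}"
  have "finite ?S" by (rule finite_subset[of _ "Pow A"]) (use assms in auto)
  moreover have "A \<in> ?S" using assms by simp
  ultimately have "\<exists>B\<in>?S. \<forall>C\<in>?S. C \<subseteq> B \<longrightarrow> B = C"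
    by (intro finite_has_minimal) auto
  then obtain B where B: "T \<subseteq> B" "B \<subseteq> A" "conn E B"
    and mn: "\<And>C. T \<subseteq> C \<Longrightarrow> C \<subseteq> A \<Longrightarrow> conn E C \<Longrightarrow> C \<subseteq> B \<Longrightarrow> B = C"
    by auto
  have "min_conn E T B" unfolding min_conn_def using B mn by (metis order.strict_iff_order order_trans)
  then show thesis using that B by simp
qed

text \<open>Otherwise the part \<open>Z\<close> of \<open>A - {v}\<close> reachable from
  \<open>y\<close> holds no terminal and touches the rest of \<open>A\<close> only at
  \<open>v\<close>. Dropping it leaves a smaller connected set with all terminals, against
  minimality.\<close>

lemma min_conn_reaches_terminal:
  assumes "symp E" "min_conn E T A" "v \<in> A" "y \<in> A - {v}"
  shows "\<exists>t\<in>T - {v}. linked E (A - {v}) y t"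
proof (rule ccontr)
  assume none: "\<not> ?thesis"
  define Z where "Z = {z. linked E (A - {v}) y z}"
  have yZ: "y \<in> Z" by (simp add: Z_def)
  have ZA: "Z \<subseteq> A - {v}" unfolding Z_def by (intro subsetI linked_mem[OF _ assms(4)]) simp
  have "T \<subseteq> A" using assms(2) by (simp add: min_conn_def)
  moreover have "t \<notin> Z" if "t \<in> T" for t using none that ZA by (auto simp: Z_def)
  ultimately have TZ: "T \<subseteq> A - Z" by auto
  have Z_back: "x \<in> Z" if "E x x'" "x \<in> A - {v}" "x' \<in> Z" for x x'
  proof -
    have "linked E (A - {v}) x' x"
      using that ZA assms(1) by (intro linked_edge) (auto dest: sympD)
    then show ?thesis using that(3) linked_trans unfolding Z_def by fast
  qed
  \<comment> \<open>By \<open>Z_back\<close>, a walk from outside \<open>Z\<close> towards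
    \<open>v\<close> cannot enter \<open>Z\<close> before it meets \<open>v\<close>, so its part up
    to \<open>v\<close> survives the removal of \<open>Z\<close>.\<close>
  have "x \<in> Z \<or> linked E (A - Z) x v" if "x \<in> A" for x
  proof -
    have "linked E A x v" using assms that by (auto simp: min_conn_def conn_def)
    then show ?thesis
      unfolding linked_def[of E A]
    proof (induction rule: converse_rtranclp_induct)
      case base
      then show ?case by simp
    next
      case (step x x')
      show ?case
      proof (cases "x \<in> Z \<or> x = v")
        case False
        then have "x' \<notin> Z" using step.hyps(1) Z_back by blast
        then have "linked E (A - Z) x x'" "linked E (A - Z) x' v"
          using step False by (auto intro: linked_edge)
        then show ?thesis by (blast intro: linked_trans)
      qed auto
    qed
  qed
  then have "conn E (A - Z)" by (intro conn_if_linked_to[OF assms(1), of _ v]) auto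
  moreover have "A - Z \<subset> A" using yZ ZA by blast
  ultimately show False using assms(2) TZ unfolding min_conn_def by blast
qed

text \<open>What the orientation argument keeps of the block structure. A vertex set as in the last
  assumption lies in one block of the graph, hence in an edge or a cycle.\<close>

locale block_cycle =
  fixes E :: "'a \<Rightarrow> 'a \<Rightarrow> bool" and V :: "'a set"
  assumes finite_V: "finite V"
    and sym_E: "symp E"
    and irrefl_E: "\<not> E x x"
    and biconnected_degree:
      "W \<subseteq> V \<Longrightarrow> conn E W \<Longrightarrow> (\<And>v. v \<in> W \<Longrightarrow> conn E (W - {v})) \<Longrightarrow> x \<in> W \<Longrightarrow> card {y \<in> W. E x y} \<le> 2"
begin

lemma E_commute: "E x y \<longleftrightarrow> E y x"
  using sym_E by (auto dest: sympD)

text \<open>The side \<open>A\<close> may fall apart when \<open>v\<close> is deleted, but by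
  minimality each piece still contains an endpoint of an edge in \<open>M\<close>, and that edge
  leads to the intact side \<open>K\<close>.\<close>

lemma conn_delete_from_pair:
  assumes A: "min_conn E (fst ` M) A" and K: "conn E K"
    and M: "M \<subseteq> A \<times> K" "\<And>p k. (p, k) \<in> M \<Longrightarrow> E p k" and disj: "A \<inter> K = {}" and v: "v \<in> A"
  shows "conn E (A \<union> K - {v})"
proof (cases "K = {}")
  case True
  then have M0: "M = {}" using M by auto
  have "A \<subseteq> {v}"
    using min_conn_reaches_terminal[OF sym_E A v] M0 by auto
  then have "A \<union> K - {v} = {}" using True by simp
  then show ?thesis by (simp only: conn_def ball_empty)
next
  case False
  then obtain k0 where k0: "k0 \<in> K" by blast
  have K': "linked E (A \<union> K - {v}) k k0" if "k \<in> K" for k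
    using K k0 that v disj unfolding conn_def by (blast intro: linked_mono)
  show ?thesis
  proof (rule conn_if_linked_to[OF sym_E, of _ k0])
    fix x assume x: "x \<in> A \<union> K - {v}"
    show "linked E (A \<union> K - {v}) x k0"
    proof (cases "x \<in> K")
      case False
      then obtain p k where pk: "(p, k) \<in> M" "p \<noteq> v" "linked E (A - {v}) x p"
        using min_conn_reaches_terminal[OF sym_E A v, of x] x by force
      then have "linked E (A \<union> K - {v}) x p" by (blast intro: linked_mono)
      moreover have "linked E (A \<union> K - {v}) p k"
        using pk M disj v by (intro linked_edge) auto
      moreover have "linked E (A \<union> K - {v}) k k0" using pk M K' by blast
      ultimately show ?thesis by (blast intro: linked_trans)
    qed (use K' in blast)
  qed
qed

text \<open>Shrinking both sides to minimal connected sets that still contain the ends of the edges makes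
  their union biconnected. Three edges between the sides would then give the union more edges than
  vertices, against the degree bound.\<close>

lemma few_edges_between:
  assumes AV: "A \<subseteq> V" "conn E A" and KV: "K \<subseteq> V" "conn E K" and disj: "A \<inter> K = {}"
    and M: "M \<subseteq> A \<times> K" "\<And>p k. (p, k) \<in> M \<Longrightarrow> E p k"
  shows "card M \<le> 2"
proof (rule ccontr)
  assume M3: "\<not> card M \<le> 2"
  have M': "E k p" if "(p, k) \<in> M" for p k using M(2) E_commute that by blast
  have fin: "finite A" "finite K" using AV KV finite_V finite_subset by auto
  have "fst ` M \<subseteq> A" "snd ` M \<subseteq> K" using M by auto
  then obtain A0 K0 where A0: "A0 \<subseteq> A" "min_conn E (fst ` M) A0"
    and K0: "K0 \<subseteq> K" "min_conn E (snd ` M) K0"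
    using min_conn_exists[OF fin(1) _ AV(2)] min_conn_exists[OF fin(2) _ KV(2)] by metis
  define S where "S = A0 \<union> K0"
  have sub: "M \<subseteq> A0 \<times> K0" 
  proof -
    have "fst ` M \<subseteq> A0" "snd ` M \<subseteq> K0" using A0(2) K0(2) by (simp_all add: min_conn_def)
    then show ?thesis by force
  qed
  have disj0: "A0 \<inter> K0 = {}" using disj A0 K0 by blast
  have fin0: "finite A0" "finite K0" using A0 K0 fin finite_subset by auto
  have cA: "conn E A0" and cK: "conn E K0" using A0 K0 unfolding min_conn_def by auto
  have "M \<noteq> {}" using M3 by auto
  then obtain p k where pk: "(p, k) \<in> M" by auto
  have c1: "conn E S" unfolding S_def
    by (rule conn_Un_edge[OF sym_E cA cK, of p k]) (use pk sub M in auto)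
  have c2: "conn E (S - {v})" if "v \<in> S" for v
  proof (cases "v \<in> A0")
    case True
    then show ?thesis unfolding S_def
      by (intro conn_delete_from_pair[OF A0(2) cK sub]) (use M disj0 in auto)
  next
    case False
    have "fst ` (M\<inverse>) = snd ` M" by force
    moreover have "E k p" if "(k, p) \<in> M\<inverse>" for k p using M' that by blast
    ultimately
    have "conn E (K0 \<union> A0 - {v})"
      by (intro conn_delete_from_pair[where M = "M\<inverse>"])
        (use K0 cA sub disj0 False that S_def in auto)
    then show ?thesis by (simp add: S_def Un_commute)
  qed
  have fS: "finite S" using fin0 by (simp add: S_def)
  have SV: "S \<subseteq> V" using A0 K0 AV KV by (auto simp: S_def)
  let ?pairs = "\<lambda>B. {(x, y). x \<in> B \<and> y \<in> B \<and> E x y}"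
  have fp: "finite (?pairs B)" if "finite B" for B
    by (rule finite_subset[of _ "B \<times> B"]) (use that in auto)
  have "?pairs S = Sigma S (\<lambda>x. {y \<in> S. E x y})" by auto
  then have "card (?pairs S) = (\<Sum>x\<in>S. card {y \<in> S. E x y})"
    using fS by simp
  also have "\<dots> \<le> (\<Sum>x\<in>S. 2)"
    by (intro sum_mono biconnected_degree[OF SV c1 c2])
  finally have up: "card (?pairs S) \<le> 2 * card S" by simp
  have fM: "finite M" "finite (M\<inverse>)" using sub fin0 finite_subset by auto
  have cM: "card (M\<inverse>) = card M" by (simp add: card_inverse)
  \<comment> \<open>The edges of \<open>M\<close> lie within neither side and count in both
    directions. With the tree bound on both sides, \<open>2 * card S + 2 * card M\<close> is at most
    \<open>card (?pairs S) + 4\<close>, hence at most \<open>2 * card S + 4\<close>.\<close>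
  have "?pairs A0 \<union> ?pairs K0 \<union> (M \<union> M\<inverse>) \<subseteq> ?pairs S"
    using sub M(2) M' by (auto simp: S_def)
  then have "card (?pairs A0 \<union> ?pairs K0 \<union> (M \<union> M\<inverse>)) \<le> card (?pairs S)"
    by (rule card_mono[OF fp[OF fS]])
  also have "card (?pairs A0 \<union> ?pairs K0 \<union> (M \<union> M\<inverse>)) = card (?pairs A0 \<union> ?pairs K0) + card (M \<union> M\<inverse>)"
    by (rule card_Un_disjoint) (use fp fin0 fM sub disj0 in auto)
  also have "card (?pairs A0 \<union> ?pairs K0) = card (?pairs A0) + card (?pairs K0)"
    by (rule card_Un_disjoint) (use fp fin0 disj0 in auto)
  also have "card (M \<union> M\<inverse>) = card M + card (M\<inverse>)"
    by (rule card_Un_disjoint) (use fM sub disj0 in auto)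
  finally have lo: "card (?pairs A0) + card (?pairs K0) + 2 * card M \<le> card (?pairs S)"
    by (simp add: cM)
  have "2 * card A0 \<le> card (?pairs A0) + 2" "2 * card K0 \<le> card (?pairs K0) + 2"
    using conn_many_pairs fin0 cA cK sym_E pk sub by blast+
  moreover have "card S = card A0 + card K0"
    unfolding S_def by (rule card_Un_disjoint[OF fin0 disj0])
  ultimately show False using lo up M3 by linarith
qed

end

subsection \<open>Orienting disjoint paths without deadlock\<close>

definition before :: "'a list \<Rightarrow> 'a \<Rightarrow> 'a \<Rightarrow> bool" where
  "before xs x y \<longleftrightarrow> (\<exists>as bs cs. xs = as @ x # bs @ y # cs)"

definition next_in :: "'a list \<Rightarrow> 'a \<Rightarrow> 'a \<Rightarrow> bool" where
  "next_in xs x y \<longleftrightarrow> (\<exists>as cs. xs = as @ x # y # cs)"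

lemma before_mem: "before xs x y \<Longrightarrow> x \<in> set xs \<and> y \<in> set xs"
  unfolding before_def by auto

lemma before_rev [simp]: "before (rev xs) x y \<longleftrightarrow> before xs y x"
proof -
  have "before (rev ys) b a" if ab: "before ys a b" for ys :: "'a list" and a b
  proof -
    obtain as bs cs where "ys = as @ a # bs @ b # cs" using ab unfolding before_def by blast
    then have "rev ys = rev cs @ b # rev bs @ a # rev as" by simp
    then show ?thesis unfolding before_def by blast
  qed
  from this[of "rev xs" x y] this[of xs y x] show ?thesis by auto
qed

lemma next_in_rev [simp]: "next_in (rev xs) x y \<longleftrightarrow> next_in xs y x"
proof -
  have "next_in (rev ys) b a" if ab: "next_in ys a b" for ys :: "'a list" and a b
  proof -
    obtain as cs where "ys = as @ a # b # cs" using ab unfolding next_in_def by blast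
    then have "rev ys = rev cs @ b # a # rev as" by simp
    then show ?thesis unfolding next_in_def by blast
  qed
  from this[of "rev xs" x y] this[of xs y x] show ?thesis by auto
qed

lemma next_in_before: "next_in xs x y \<Longrightarrow> before xs x y"
  unfolding next_in_def before_def by (metis append_Nil)

lemma before_asym:
  assumes "distinct xs" "before xs x y" shows "\<not> before xs y x"
proof
  assume yx: "before xs y x"
  obtain as bs cs where xs: "xs = as @ x # bs @ y # cs" using assms unfolding before_def by blast
  obtain as' bs' cs' where xs': "xs = as' @ y # bs' @ x # cs'" using yx unfolding before_def by blast
  have "as @ x # (bs @ y # cs) = (as' @ y # bs') @ x # cs'" using xs xs' by simp
  then have "as = as' @ y # bs'"
    using assms(1) xs by (metis append_Cons_eq_iff distinct_append not_distinct_conv_prefix distinct.simps(2) disjoint_iff list.set_intros(1) xs')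
  then show False using assms(1) xs by auto
qed

lemma conn_walk: "symp E \<Longrightarrow> successively E xs \<Longrightarrow> conn E (set xs)"
proof (induction xs rule: induct_list012)
  case (3 x y zs)
  have "conn E ({x} \<union> set (y # zs))"
    by (rule conn_Un_edge[where a = x and b = y]) (use 3 in \<open>auto simp: conn_def\<close>)
  then show ?case by (simp add: insert_commute)
qed (auto simp: conn_def)

text \<open>\<open>z\<close> is the predecessor of \<open>y\<close>. The stretch from
  \<open>x\<close> to \<open>z\<close> avoids \<open>y\<close> because the list is distinct, so the
  link to \<open>x\<close> survives the deletion of \<open>y\<close>.\<close>

lemma before_walk:
  assumes "symp E" "distinct xs" "successively E xs" "before xs x y"
  obtains z where "E z y" "next_in xs z y" "linked E (set xs - {y}) z x"
proof -
  obtain as bs cs where xs: "xs = as @ x # bs @ y # cs" using assms unfolding before_def by blast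
  define zs where "zs = x # bs"
  define z where "z = last zs"
  have zs: "zs \<noteq> []" "xs = as @ zs @ y # cs" by (simp_all add: zs_def xs)
  have "successively E (zs @ y # cs)"
    using assms(3) unfolding zs(2) by (simp only: successively_append_iff)
  then have su: "successively E zs" "E z y"
    using zs(1) unfolding z_def by (simp_all add: successively_append_iff)
  have "xs = (as @ butlast zs) @ z # y # cs" using zs by (simp add: z_def)
  then have "next_in xs z y" unfolding next_in_def by blast
  moreover have "linked E (set zs) z x"
    using conn_walk[OF assms(1) su(1)] zs(1) unfolding conn_def z_def by (simp add: zs_def)
  then have "linked E (set xs - {y}) z x"
    by (rule linked_mono) (use assms(2) zs(2) in auto)
  ultimately show thesis using that su(2) by blast
qed

section \<open>Orientations and cyclic waiting\<close>

definition orient :: "('a list \<Rightarrow> bool) \<Rightarrow> 'a list \<Rightarrow> 'a list" where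
  "orient \<sigma> xs = (if \<sigma> xs then xs else rev xs)"

lemma set_orient [simp]: "set (orient \<sigma> xs) = set xs"
  by (simp add: orient_def)

text \<open>The vertex \<open>u xs\<close> stands for the last black vertex of the path \<open>xs\<close>, oriented by \<open>\<sigma>\<close>: it cannot
  force because of the white neighbour \<open>w\<close> on another stuck path.\<close>

definition deadlock ::
    "('a \<Rightarrow> 'a \<Rightarrow> bool) \<Rightarrow> ('a list \<Rightarrow> bool) \<Rightarrow> 'a list set \<Rightarrow> ('a list \<Rightarrow> 'a) \<Rightarrow> bool" where
  "deadlock E \<sigma> D u \<longleftrightarrow> D \<noteq> {} \<and>
     (\<forall>xs\<in>D. u xs \<in> set xs \<and>
        (\<exists>ys\<in>D. ys \<noteq> xs \<and> (\<exists>w. E (u xs) w \<and> before (orient \<sigma> ys) (u ys) w)))"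

lemma deadlock_cong:
  "(\<And>xs. xs \<in> D \<Longrightarrow> \<sigma> xs = \<tau> xs) \<Longrightarrow> deadlock E \<sigma> D u \<longleftrightarrow> deadlock E \<tau> D u"
  unfolding deadlock_def orient_def by simp

lemma deadlock_step:
  assumes "deadlock E \<sigma> D u" "xs \<in> D"
  obtains ys w where "ys \<in> D" "ys \<noteq> xs" "E (u xs) w" "before (orient \<sigma> ys) (u ys) w"
  using assms unfolding deadlock_def by blast

text \<open>The positions \<open>u\<close> are inherited, so a subfamily of a deadlock is again one
  as soon as waiting stays inside it.\<close>

lemma deadlockI:
  assumes "D' \<noteq> {}" "D' \<subseteq> D" "deadlock E \<sigma> D u"
    and "\<And>xs. xs \<in> D' \<Longrightarrow>
      \<exists>ys\<in>D'. ys \<noteq> xs \<and> (\<exists>w. E (u xs) w \<and> before (orient \<sigma> ys) (u ys) w)"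
  shows "deadlock E \<sigma> D' u"
  using assms unfolding deadlock_def by blast

text \<open>In a minimal deadlock every path is waited for, so the roles of the waiting and the
  awaited vertices can be exchanged.\<close>

lemma deadlock_reverse:
  assumes "symp E" "finite D" "deadlock E \<sigma> D u"
  obtains D' u' where "D' \<subseteq> D" "deadlock E (\<lambda>xs. \<not> \<sigma> xs) D' u'"
proof -
  let ?S = "{D'. D' \<subseteq> D \<and> deadlock E \<sigma> D' u}"
  have "\<exists>D'\<in>?S. \<forall>C\<in>?S. C \<subseteq> D' \<longrightarrow> D' = C"
    by (rule finite_has_minimal) (use assms in auto)
  then obtain D' where S: "D' \<in> ?S" and mn: "\<forall>C\<in>?S. C \<subseteq> D' \<longrightarrow> D' = C" by (rule bexE)
  then have D': "D' \<subseteq> D" and dl: "deadlock E \<sigma> D' u" by simp_all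
  have "\<forall>xs\<in>D'. \<exists>p. fst p \<in> D' \<and> fst p \<noteq> xs \<and> E (u xs) (snd p) \<and>
      before (orient \<sigma> (fst p)) (u (fst p)) (snd p)"
  proof
    fix xs assume "xs \<in> D'"
    then obtain ys w where "ys \<in> D'" "ys \<noteq> xs" "E (u xs) w" "before (orient \<sigma> ys) (u ys) w"
      by (rule deadlock_step[OF dl])
    then show "\<exists>p. fst p \<in> D' \<and> fst p \<noteq> xs \<and> E (u xs) (snd p) \<and>
      before (orient \<sigma> (fst p)) (u (fst p)) (snd p)" by (intro exI[of _ "(ys, w)"]) simp
  qed
  from bchoice[OF this] obtain h where h: "\<forall>xs\<in>D'. fst (h xs) \<in> D' \<and> fst (h xs) \<noteq> xs \<and>
     E (u xs) (snd (h xs)) \<and> before (orient \<sigma> (fst (h xs))) (u (fst (h xs))) (snd (h xs))" by (rule exE)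
  define f where "f xs = fst (h xs)" for xs
  define w where "w xs = snd (h xs)" for xs
  have fw: "f xs \<in> D'" "f xs \<noteq> xs" "E (u xs) (w xs)" "before (orient \<sigma> (f xs)) (u (f xs)) (w xs)"
    if "xs \<in> D'" for xs
    using bspec[OF h that] unfolding f_def w_def by simp_all
  have sub: "f ` D' \<subseteq> D'" using fw(1) by blast
  \<comment> \<open>Each path in the image of \<open>f\<close> waits for another path in the image,
    so minimality makes \<open>f\<close> map onto \<open>D'\<close>.\<close>
  have "f ` D' \<in> ?S"
  proof (intro CollectI conjI)
    show "f ` D' \<subseteq> D" using sub D' by (rule order_trans)
    show "deadlock E \<sigma> (f ` D') u"
    proof (rule deadlockI[OF _ sub dl])
      show "f ` D' \<noteq> {}" using dl by (simp add: deadlock_def)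
      fix xs assume "xs \<in> f ` D'"
      then have "xs \<in> D'" using sub by blast
      then show "\<exists>ys\<in>f ` D'. ys \<noteq> xs \<and> (\<exists>w. E (u xs) w \<and> before (orient \<sigma> ys) (u ys) w)"
        using fw by (intro bexI[of _ "f xs"]) blast+
    qed
  qed
  then have "D' = f ` D'" using mn sub by simp
  then have "D' \<subseteq> f ` D'" by (rule equalityD1)
  then have "\<forall>ys\<in>D'. \<exists>xs. xs \<in> D' \<and> f xs = ys" by blast
  from bchoice[OF this] obtain g where g': "\<forall>ys\<in>D'. g ys \<in> D' \<and> f (g ys) = ys" by (rule exE)
  have g: "g ys \<in> D' \<and> f (g ys) = ys" if "ys \<in> D'" for ys using bspec[OF g' that] .
  have gb: "before (orient \<sigma> ys) (u ys) (w (g ys))" if "ys \<in> D'" for ys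
    using fw(4)[of "g ys"] g[OF that] by simp
  have rv: "before (orient (\<lambda>xs. \<not> \<sigma> xs) ys) x y \<longleftrightarrow> before (orient \<sigma> ys) y x" for ys x y
    by (simp add: orient_def)
  \<comment> \<open>Now \<open>ys\<close> waits for \<open>g ys\<close>, which used to wait for it,
    through the same edge: the former awaited vertex \<open>w (g ys)\<close> waits, and
    \<open>u (g ys)\<close>, which lies after \<open>w (g (g ys))\<close> on the reversed
    \<open>g ys\<close>, is awaited.\<close>
  have "deadlock E (\<lambda>xs. \<not> \<sigma> xs) D' (\<lambda>ys. w (g ys))"
    unfolding deadlock_def
  proof (intro conjI ballI)
    show "D' \<noteq> {}" using dl by (simp add: deadlock_def)
    fix ys assume ys: "ys \<in> D'"
    show "w (g ys) \<in> set ys" using before_mem[OF gb[OF ys]] by simp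
    have "E (w (g ys)) (u (g ys))" using fw(3)[of "g ys"] g[OF ys] assms(1) by (auto dest: sympD)
    moreover have "g ys \<noteq> ys" using fw(2)[of "g ys"] g[OF ys] by metis
    ultimately show "\<exists>zs\<in>D'. zs \<noteq> ys \<and>
        (\<exists>v. E (w (g ys)) v \<and> before (orient (\<lambda>xs. \<not> \<sigma> xs) zs) (w (g zs)) v)"
      using gb g[OF ys] unfolding rv by blast
  qed
  then show thesis using that D' by blast
qed

definition disjoint_walks :: "('a \<Rightarrow> 'a \<Rightarrow> bool) \<Rightarrow> 'a set \<Rightarrow> 'a list set \<Rightarrow> bool" where
  "disjoint_walks E V L \<longleftrightarrow> finite L \<and>
     (\<forall>xs\<in>L. xs \<noteq> [] \<and> distinct xs \<and> successively E xs \<and> set xs \<subseteq> V) \<and>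
     (\<forall>xs\<in>L. \<forall>ys\<in>L. xs \<noteq> ys \<longrightarrow> set xs \<inter> set ys = {})"

lemma orient_before_walk:
  assumes "symp E" "distinct xs" "successively E xs" "before (orient \<sigma> xs) x y"
  obtains z where "E z y" "next_in (orient \<sigma> xs) z y" "linked E (set xs - {y}) z x"
proof -
  have "successively E (rev xs)"
    unfolding successively_rev
    by (rule successively_mono[OF assms(3)]) (use assms(1) in \<open>auto dest: sympD\<close>)
  then have "successively E (orient \<sigma> xs)" "distinct (orient \<sigma> xs)"
    using assms(2,3) by (simp_all add: orient_def)
  from before_walk[OF assms(1) this(2,1) assms(4)] that show thesis by auto
qed

text \<open>A deadlock that needs \<open>P\<close> leaves \<open>P\<close> through an edge \<open>ak\<close> and returns to it through an edge \<open>bl\<close>;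
  in between it connects the predecessor \<open>z\<close> of \<open>k\<close> with \<open>a\<close> while avoiding \<open>k\<close>.\<close>

lemma deadlock_through:
  assumes sym: "symp E" and L: "disjoint_walks E V L" and DL: "D \<subseteq> L" and PD: "P \<in> D"
    and dl: "deadlock E \<sigma> D u" and no: "\<And>D' u'. D' \<subseteq> D - {P} \<Longrightarrow> \<not> deadlock E \<sigma> D' u'"
    and K: "\<And>xs. xs \<in> D - {P} \<Longrightarrow> set xs \<subseteq> K" and PK: "set P \<inter> K = {}"
  obtains a b k l Q z where "before (orient \<sigma> P) a b" "E a k" "E b l" "k \<in> K" "l \<in> K"
    "Q \<in> D - {P}" "k \<in> set Q" "next_in (orient \<sigma> Q) z k" "E z k" 
    "linked E (set P \<union> K - {k}) z a"
proof -
  have walk: "distinct xs" "successively E xs" if "xs \<in> D" for xs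
    using L DL that unfolding disjoint_walks_def by auto
  have disj: "set xs \<inter> set ys = {}" if "xs \<in> D" "ys \<in> D" "xs \<noteq> ys" for xs ys
    using L DL that unfolding disjoint_walks_def by blast
  define a where "a = u P"
  obtain Q k where Q: "Q \<in> D" "Q \<noteq> P" "E a k" "before (orient \<sigma> Q) (u Q) k"
    unfolding a_def by (rule deadlock_step[OF dl PD])
  have kQ: "k \<in> set Q" using before_mem[OF Q(4)] by simp
  have kK: "k \<in> K" using K[of Q] Q kQ by blast
  have us: "u xs \<in> set xs" if "xs \<in> D" for xs using dl that by (simp add: deadlock_def)
  \<comment> \<open>If no other path waited for \<open>P\<close>, the remaining paths would be a
    deadlock without \<open>P\<close>.\<close>
  have ex: "\<exists>xs\<in>D - {P}. \<exists>b. E (u xs) b \<and> before (orient \<sigma> P) a b"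
  proof (rule ccontr)
    assume none: "\<not> ?thesis"
    have "deadlock E \<sigma> (D - {P}) u"
    proof (rule deadlockI[OF _ Diff_subset dl])
      show "D - {P} \<noteq> {}" using Q by blast
      fix xs assume xs: "xs \<in> D - {P}"
      then obtain ys w where ys: "ys \<in> D" "ys \<noteq> xs" "E (u xs) w" "before (orient \<sigma> ys) (u ys) w"
        using deadlock_step[OF dl, of xs] by blast
      then have "ys \<noteq> P" using none xs unfolding a_def by blast
      then show "\<exists>ys\<in>D - {P}. ys \<noteq> xs \<and> (\<exists>w. E (u xs) w \<and> before (orient \<sigma> ys) (u ys) w)"
        using ys by blast
    qed
    then show False using no by blast
  qed
  then obtain xs b where xs: "xs \<in> D - {P}" "E (u xs) b" "before (orient \<sigma> P) a b" by blast
  have lK: "u xs \<in> K" using xs(1) us K by blast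
  have Eb: "E b (u xs)" using xs(2) sym by (auto dest: sympD)
  obtain z where z: "E z k" "next_in (orient \<sigma> Q) z k" "linked E (set Q - {k}) z (u Q)"
    using orient_before_walk[OF sym walk[OF Q(1)] Q(4)] by blast
  let ?X = "set P \<union> K - {k}"
  have PX: "set P \<subseteq> ?X" using PK kK by blast
  have "linked E ?X (u Q) a"
  proof (rule ccontr)
    assume bad: "\<not> ?thesis"
    \<comment> \<open>Paths in \<open>T\<close> turn out to wait only for paths in \<open>T\<close>,
      which makes \<open>T\<close> a deadlock without \<open>P\<close>.\<close>
    define T where "T = {xs \<in> D - {P}. \<not> linked E ?X (u xs) a}"
    have QT: "Q \<in> T" using bad Q by (simp add: T_def)
    have "deadlock E \<sigma> T u"
    proof (rule deadlockI[OF _ _ dl])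
      show "T \<noteq> {}" "T \<subseteq> D" using QT unfolding T_def by auto
      fix xs assume xs: "xs \<in> T"
      then have xsD: "xs \<in> D" "xs \<noteq> P" "\<not> linked E ?X (u xs) a" by (simp_all add: T_def)
      obtain ys w where ys: "ys \<in> D" "ys \<noteq> xs" "E (u xs) w" "before (orient \<sigma> ys) (u ys) w"
        by (rule deadlock_step[OF dl xsD(1)])
      have w: "w \<in> set ys" using before_mem[OF ys(4)] by simp
      have "ys \<in> T"
      \<comment> \<open>The case \<open>ys = Q\<close> is separate because the stretch of
        \<open>Q\<close> between \<open>w\<close> and \<open>u Q\<close> may run through the deleted
        vertex \<open>k\<close>; there membership in \<open>T\<close> is known already.\<close>
      proof (cases "ys = Q")
        case False
        have ysX: "set ys \<subseteq> ?X"
        proof (cases "ys = P")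
          case False
          then have "set ys \<subseteq> K" using K ys(1) by blast
          moreover have "k \<notin> set ys" using disj[OF ys(1) Q(1) \<open>ys \<noteq> Q\<close>] kQ by blast
          ultimately show ?thesis by blast
        qed (use PX in simp)
        \<comment> \<open>\<open>k\<close> comes strictly after \<open>u Q\<close> on
          \<open>Q\<close>, so deleting it removes no waiting vertex.\<close>
        have "u xs \<noteq> k"
        proof
          assume "u xs = k"
          then have "xs = Q" using disj[OF xsD(1) Q(1)] us[OF xsD(1)] kQ by blast
          then show False using \<open>u xs = k\<close> Q(4) before_asym[of "orient \<sigma> Q"] walk[OF Q(1)]
            by (auto simp: orient_def split: if_splits)
        qed
        then have "u xs \<in> ?X" using us[OF xsD(1)] K[of xs] xsD by blast
        then have "linked E ?X (u xs) w" using ys(3) w ysX by (intro linked_edge) auto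
        moreover have "linked E ?X w (u ys)"
          using conn_walk[OF sym walk(2)[OF ys(1)]] w us[OF ys(1)] ysX
          unfolding conn_def by (blast intro: linked_mono)
        ultimately have "linked E ?X (u xs) (u ys)" by (rule linked_trans)
        then have "\<not> linked E ?X (u ys) a" using xsD(3) linked_trans by metis
        moreover from this have "ys \<noteq> P" using a_def linked_refl by metis
        ultimately show ?thesis using ys(1) by (simp add: T_def)
      qed (use QT in simp)
      then show "\<exists>ys\<in>T. ys \<noteq> xs \<and> (\<exists>w. E (u xs) w \<and> before (orient \<sigma> ys) (u ys) w)"
        using ys by blast
    qed
    moreover have "T \<subseteq> D - {P}" by (auto simp: T_def)
    ultimately show False using no by blast
  qed
  moreover have "linked E ?X z (u Q)"
    by (rule linked_mono[OF z(3)]) (use K[of Q] Q in blast)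
  ultimately have "linked E ?X z a" by (blast intro: linked_trans)
  then show thesis
    using that[of a b k "u xs" Q z] xs(3) Q kQ kK lK Eb z by blast
qed

context block_cycle
begin

text \<open>When a path \<open>P\<close> is added, the paths in those components \<open>K\<close> of the old union that are in a
  deadlock with \<open>P\<close> are reversed. A deadlock of \<open>P\<close> with a reversed \<open>K\<close> would use the same two edges
  between \<open>P\<close> and \<open>K\<close> as the old one, and then the first vertex \<open>k1\<close> in \<open>K\<close> would have three
  neighbours in one component of the rest: \<open>a1\<close> on \<open>P\<close> and its two neighbours on its own path.\<close>

lemma orientation_exists:
  assumes "disjoint_walks E V L"
  shows "\<exists>\<sigma>. \<forall>D u. D \<subseteq> L \<longrightarrow> \<not> deadlock E \<sigma> D u"
proof -
  have "finite L" using assms by (simp add: disjoint_walks_def)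
  then show ?thesis using assms
  proof (induction L rule: finite_induct)
    case empty
    show ?case by (simp add: deadlock_def)
  next
    case (insert P L)
    have L: "disjoint_walks E V L" using insert.prems unfolding disjoint_walks_def by simp
    then obtain \<sigma> where no: "\<And>D u. D \<subseteq> L \<Longrightarrow> \<not> deadlock E \<sigma> D u" using insert.IH by blast
    have finL: "finite D" if "D \<subseteq> L" for D using that insert.hyps(1) by (rule finite_subset)
    have no_rev: "\<not> deadlock E (\<lambda>xs. \<not> \<sigma> xs) D u" if D: "D \<subseteq> L" for D u
    proof
      assume "deadlock E (\<lambda>xs. \<not> \<sigma> xs) D u"
      then obtain D' u' where "D' \<subseteq> D" "deadlock E (\<lambda>xs. \<not> \<not> \<sigma> xs) D' u'"
        by (rule deadlock_reverse[OF sym_E finL[OF D]])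
      then show False using no[of D' u'] D by simp
    qed
    define U where "U = \<Union> (set ` L)"
    \<comment> \<open>Each path of \<open>L\<close> lies within one component of the old union
      \<open>U\<close>, so its head can represent it.\<close>
    define same where "same xs ys \<longleftrightarrow> linked E U (hd xs) (hd ys)" for xs ys
    have same_refl: "same xs xs" for xs by (simp add: same_def)
    have same_sym: "same xs ys \<Longrightarrow> same ys xs" for xs ys
      unfolding same_def by (rule linked_sym[OF sym_E])
    have same_trans: "same xs ys \<Longrightarrow> same ys zs \<Longrightarrow> same xs zs" for xs ys zs
      unfolding same_def by (rule linked_trans)
    have walk: "xs \<noteq> []" "distinct xs" "successively E xs" "set xs \<subseteq> V" if "xs \<in> insert P L" for xs
      using insert.prems that unfolding disjoint_walks_def by blast+
    have disj: "set xs \<inter> set ys = {}" if "xs \<in> insert P L" "ys \<in> insert P L" "xs \<noteq> ys" for xs ys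
      using insert.prems that unfolding disjoint_walks_def by blast
    have hd_linked: "linked E U (hd xs) x" if "xs \<in> L" "x \<in> set xs" for xs x
    proof -
      have "linked E (set xs) (hd xs) x"
        using conn_walk[OF sym_E walk(3)[of xs]] walk(1)[of xs] that unfolding conn_def by simp
      then show ?thesis by (rule linked_mono) (use that in \<open>auto simp: U_def\<close>)
    qed
    have same_edge: "same xs ys" if "xs \<in> L" "ys \<in> L" "x \<in> set xs" "y \<in> set ys" "E x y" for xs ys x y
    proof -
      have "linked E U x y" by (rule linked_edge) (use that in \<open>auto simp: U_def\<close>)
      then show ?thesis
        unfolding same_def
        using hd_linked[of xs x] linked_sym[OF sym_E hd_linked[of ys y]] that linked_trans by metis
    qed
    define bad where "bad xs \<longleftrightarrow> (\<exists>D u. D \<subseteq> insert P L \<and> P \<in> D \<and> deadlock E \<sigma> D u \<and>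
        (\<forall>ys\<in>D - {P}. same xs ys))" for xs
    have bad_same: "bad ys" if "bad xs" "same xs ys" for xs ys
      using that(1) same_trans[OF same_sym[OF that(2)]] unfolding bad_def by blast
    \<comment> \<open>By \<open>bad_same\<close> a component is reversed as a whole or not at all.
      \<open>P\<close> keeps its direction, which lets the old and the new deadlock be compared
      along the same list \<open>?P\<close>.\<close>
    define \<tau> where "\<tau> xs = (if xs \<noteq> P \<and> bad xs then \<not> \<sigma> xs else \<sigma> xs)" for xs
    have no_\<tau>: "\<not> deadlock E \<tau> D u" if D: "D \<subseteq> L" for D u
    proof
      assume dl: "deadlock E \<tau> D u"
      then obtain xs where xs: "xs \<in> D" by (auto simp: deadlock_def)
      \<comment> \<open>Waiting among old paths stays inside a component, so one component already
        carries a deadlock, and on it \<open>\<tau>\<close> is either \<open>\<sigma>\<close> or its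
        opposite.\<close>
      define C where "C = {ys \<in> D. same xs ys}"
      have CL: "C \<subseteq> L" using D by (auto simp: C_def)
      have "deadlock E \<tau> C u"
      proof (rule deadlockI[OF _ _ dl])
        show "C \<noteq> {}" "C \<subseteq> D" using xs same_refl by (auto simp: C_def)
        fix ys assume ys: "ys \<in> C"
        then have ysD: "ys \<in> D" by (simp add: C_def)
        obtain zs w where zs: "zs \<in> D" "zs \<noteq> ys" "E (u ys) w" "before (orient \<tau> zs) (u zs) w"
          by (rule deadlock_step[OF dl ysD])
        have "same ys zs"
          by (rule same_edge[of _ _ "u ys" w])
            (use zs ysD D dl before_mem[OF zs(4)] in \<open>auto simp: deadlock_def\<close>)
        then have "zs \<in> C" using ys zs(1) same_trans[of xs ys zs] by (simp add: C_def)
        then show "\<exists>zs\<in>C. zs \<noteq> ys \<and> (\<exists>w. E (u ys) w \<and> before (orient \<tau> zs) (u zs) w)"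
          using zs by blast
      qed
      moreover have "\<tau> ys = (if bad xs then \<not> \<sigma> ys else \<sigma> ys)" if "ys \<in> C" for ys
      proof -
        have "same xs ys" "ys \<noteq> P" using that CL insert.hyps(2) by (auto simp: C_def)
        then have "bad ys \<longleftrightarrow> bad xs" using bad_same same_sym by blast
        then show ?thesis using \<open>ys \<noteq> P\<close> by (simp add: \<tau>_def)
      qed
      ultimately have "deadlock E (\<lambda>ys. if bad xs then \<not> \<sigma> ys else \<sigma> ys) C u"
        using deadlock_cong[of C \<tau> "\<lambda>ys. if bad xs then \<not> \<sigma> ys else \<sigma> ys" E u] by simp
      then show False using no[OF CL] no_rev[OF CL] by (cases "bad xs") simp_all
    qed
    have "\<not> deadlock E \<tau> D u" if D: "D \<subseteq> insert P L" for D u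
    proof
      assume dl: "deadlock E \<tau> D u"
      have PD: "P \<in> D" using no_\<tau>[of D u] D dl by blast
      obtain Q w where Q: "Q \<in> D" "Q \<noteq> P" "E (u P) w" "before (orient \<tau> Q) (u Q) w"
        by (rule deadlock_step[OF dl PD])
      have QL: "Q \<in> L" using Q D by blast
      \<comment> \<open>A path in the component of \<open>Q\<close> waits within that component or
        for \<open>P\<close>, so \<open>P\<close> and this component alone form a deadlock.\<close>
      define D2 where "D2 = insert P {ys \<in> D - {P}. same Q ys}"
      have D2: "D2 \<subseteq> D" "D2 \<subseteq> insert P L" "P \<in> D2" using PD D by (auto simp: D2_def)
      have dl2: "deadlock E \<tau> D2 u"
      proof (rule deadlockI[OF _ D2(1) dl])
        show "D2 \<noteq> {}" using D2(3) by blast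
        fix ys assume ys: "ys \<in> D2"
        show "\<exists>zs\<in>D2. zs \<noteq> ys \<and> (\<exists>w. E (u ys) w \<and> before (orient \<tau> zs) (u zs) w)"
        proof (cases "ys = P")
          case True
          have "Q \<in> D2" using Q same_refl by (simp add: D2_def)
          then show ?thesis using Q True by blast
        next
          case False
          have ysD: "ys \<in> D" using ys D2(1) by blast
          obtain zs w where zs: "zs \<in> D" "zs \<noteq> ys" "E (u ys) w" "before (orient \<tau> zs) (u zs) w"
            by (rule deadlock_step[OF dl ysD])
          have "zs \<in> D2"
          proof (cases "zs = P")
            case False
            have "same ys zs"
              by (rule same_edge[of _ _ "u ys" w])
                (use zs ysD D dl \<open>ys \<noteq> P\<close> False before_mem[OF zs(4)] in \<open>auto simp: deadlock_def\<close>)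
            then show ?thesis
              using ys \<open>ys \<noteq> P\<close> False zs(1) same_trans[of Q ys zs] by (simp add: D2_def)
          qed (use D2(3) in simp)
          then show ?thesis using zs by blast
        qed
      qed
      have sameQ: "same Q ys" if "ys \<in> D2 - {P}" for ys using that by (simp add: D2_def)
      have badQ: "bad Q"
      proof (rule ccontr)
        assume nb: "\<not> bad Q"
        have "\<tau> ys = \<sigma> ys" if "ys \<in> D2" for ys
        proof (cases "ys = P")
          case False
          then have "\<not> bad ys" using that sameQ[of ys] nb bad_same[of ys Q] same_sym[of Q ys] by blast
          then show ?thesis by (simp add: \<tau>_def)
        qed (simp add: \<tau>_def)
        then have "deadlock E \<sigma> D2 u" using dl2 deadlock_cong[of D2 \<tau> \<sigma> E u] by simp
        then have "bad Q" unfolding bad_def using D2 sameQ by blast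
        then show False using nb by blast
      qed
      \<comment> \<open>\<open>D1\<close> is the deadlock that made the component bad,
        \<open>D2\<close> the one present after its reversal. Both consist of \<open>P\<close> and
        paths inside the same component \<open>K\<close>.\<close>
      then obtain D1 u1 where D1: "D1 \<subseteq> insert P L" "P \<in> D1" and dl1: "deadlock E \<sigma> D1 u1"
        and sameQ1: "\<And>ys. ys \<in> D1 - {P} \<Longrightarrow> same Q ys" unfolding bad_def by blast
      define K where "K = {z. linked E U (hd Q) z}"
      have connK: "conn E K" unfolding K_def by (rule conn_component[OF sym_E])
      have "hd Q \<in> U" using QL walk(1)[of Q] by (force simp: U_def)
      then have KU: "K \<subseteq> U" unfolding K_def using linked_mem[of E U "hd Q"] by blast
      have UV: "U \<subseteq> V" using walk(4) by (auto simp: U_def)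
      have PU: "set P \<inter> U = {}" using disj[of P] insert.hyps(2) by (auto simp: U_def)
      have PK: "set P \<inter> K = {}" using PU KU by blast
      have inK: "set xs \<subseteq> K" if "xs \<in> L" "same Q xs" for xs
        
      proof
        fix x assume "x \<in> set xs"
        then have "linked E U (hd xs) x" by (rule hd_linked[OF that(1)])
        then show "x \<in> K"
          using that(2) unfolding K_def same_def mem_Collect_eq by (rule linked_trans[rotated])
      qed
      obtain a1 b1 k1 l1 Q1 z1 where e1: "before (orient \<sigma> P) a1 b1" "E a1 k1" "E b1 l1" "k1 \<in> K" "l1 \<in> K"
        "Q1 \<in> D1 - {P}" "k1 \<in> set Q1" "next_in (orient \<sigma> Q1) z1 k1" "E z1 k1"
        "linked E (set P \<union> K - {k1}) z1 a1"
      proof (rule deadlock_through[OF sym_E insert.prems D1 dl1 _ _ PK])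
        show "\<not> deadlock E \<sigma> D' u'" if "D' \<subseteq> D1 - {P}" for D' u' using no[of D' u'] that D1(1) by blast
        show "set xs \<subseteq> K" if "xs \<in> D1 - {P}" for xs using inK[of xs] sameQ1[of xs] that D1(1) by blast
      qed
      obtain a2 b2 k2 l2 Q2 z2 where e2: "before (orient \<tau> P) a2 b2" "E a2 k2" "E b2 l2" "k2 \<in> K" "l2 \<in> K"
        "Q2 \<in> D2 - {P}" "k2 \<in> set Q2" "next_in (orient \<tau> Q2) z2 k2" "E z2 k2"
        "linked E (set P \<union> K - {k2}) z2 a2"
      proof (rule deadlock_through[OF sym_E insert.prems D2(2,3) dl2 _ _ PK])
        show "\<not> deadlock E \<tau> D' u'" if "D' \<subseteq> D2 - {P}" for D' u' using no_\<tau>[of D' u'] that D2(2) by blast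
        show "set xs \<subseteq> K" if "xs \<in> D2 - {P}" for xs using inK[of xs] sameQ[of xs] that D2(2) by blast
      qed
      let ?P = "orient \<sigma> P"
      have "orient \<tau> P = ?P" by (simp add: orient_def \<tau>_def)
      then have ab2: "before ?P a2 b2" using e2(1) by simp
      have dP: "distinct ?P" using walk(2)[of P] by (simp add: orient_def)
      have mem: "a1 \<in> set P" "b1 \<in> set P" "a2 \<in> set P" "b2 \<in> set P"
        using before_mem[OF e1(1)] before_mem[OF ab2] by simp_all
      have ne: "a1 \<noteq> b1" "a2 \<noteq> b2" using before_asym[OF dP] e1(1) ab2 by blast+
      define M where "M = {(a1, k1), (b1, l1), (a2, k2), (b2, l2)}"
      have "card M \<le> 2"
      proof (rule few_edges_between[of "set P" K])
        show "set P \<subseteq> V" "conn E (set P)" using walk[of P] conn_walk[OF sym_E] by auto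
        show "K \<subseteq> V" using KU UV by blast
        show "conn E K" by (rule connK)
        show "set P \<inter> K = {}" by (rule PK)
        show "M \<subseteq> set P \<times> K" using mem e1 e2 by (auto simp: M_def)
        show "E p k" if "(p, k) \<in> M" for p k using that e1 e2 by (auto simp: M_def)
      qed
      moreover have "finite M" by (simp add: M_def)
      moreover have two: "card {(a1, k1), (b1, l1)} = 2" using ne by simp
      ultimately have M2: "M = {(a1, k1), (b1, l1)}"
        using card_seteq[of M "{(a1, k1), (b1, l1)}"] by (auto simp: M_def)
      \<comment> \<open>The two edges of \<open>D2\<close> are the two edges of \<open>D1\<close>.
        Matching them crosswise would put \<open>b1\<close> before \<open>a1\<close> on
        \<open>?P\<close>.\<close>
      have "a2 = a1 \<and> k2 = k1"
      proof (rule ccontr)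
        assume "\<not> ?thesis"
        moreover have "(a2, k2) \<in> {(a1, k1), (b1, l1)}" "(b2, l2) \<in> {(a1, k1), (b1, l1)}"
          unfolding M2[symmetric] by (simp_all add: M_def)
        ultimately have "a2 = b1" "b2 = a1" using ne by auto
        then show False using before_asym[OF dP e1(1)] ab2 by blast
      qed
      then have eq: "a2 = a1" "k2 = k1" by simp_all
      have Q12: "Q2 = Q1"
        using disj[of Q1 Q2] e1(6,7) e2(6,7) D1(1) D2(2) eq by blast
      have Q1L: "Q1 \<in> L" "Q1 \<noteq> P" using e1(6) D1(1) by auto
      have "bad Q1" using bad_same[OF badQ] sameQ[of Q2] e2(6) Q12 by blast
      \<comment> \<open>The predecessor \<open>z2\<close> of \<open>k1\<close> under
        \<open>\<tau>\<close> is therefore its successor under \<open>\<sigma>\<close>, which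
        separates it from \<open>z1\<close>.\<close>
      then have "orient \<tau> Q1 = rev (orient \<sigma> Q1)" using Q1L by (simp add: orient_def \<tau>_def)
      then have "next_in (orient \<sigma> Q1) k1 z2" using e2(8) Q12 eq by simp
      then have z12: "z1 \<noteq> z2"
        using before_asym[of "orient \<sigma> Q1" z1 k1] next_in_before[OF e1(8)] next_in_before[of "orient \<sigma> Q1" k1 z2]
          walk(2)[of Q1] Q1L by (auto simp: orient_def split: if_splits)
      have "z1 \<in> set Q1" "z2 \<in> set Q1"
        using before_mem[OF next_in_before[OF e1(8)]] before_mem[OF next_in_before[OF \<open>next_in (orient \<sigma> Q1) k1 z2\<close>]]
        by simp_all
      then have za: "z1 \<noteq> a1" "z2 \<noteq> a1" using mem(1) disj[of P Q1] Q1L by blast+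
      let ?X = "set P \<union> K - {k1}"
      \<comment> \<open>Both links avoid \<open>k1\<close>, so \<open>z1\<close>, \<open>z2\<close>
        and \<open>a1\<close> lie in one component of \<open>?X\<close>; the edge bound is applied
        with \<open>{k1}\<close> as the other side.\<close>
      define X where "X = {y. linked E ?X a1 y}"
      have aX: "a1 \<in> ?X" using mem(1) PK e1(4) by blast
      then have XX: "X \<subseteq> ?X" unfolding X_def using linked_mem[of E ?X a1] by blast
      have memX: "z1 \<in> X" "z2 \<in> X" "a1 \<in> X"
        using linked_sym[OF sym_E e1(10)] linked_sym[OF sym_E e2(10)] eq by (simp_all add: X_def)
      have "card {(k1, z1), (k1, z2), (k1, a1)} \<le> 2"
      proof (rule few_edges_between[of "{k1}" X])
        show "{k1} \<subseteq> V" using e1(4) KU UV by blast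
        show "conn E {k1}" by (simp add: conn_def)
        show "X \<subseteq> V" using XX KU UV walk(4)[of P] by blast
        show "conn E X" unfolding X_def by (rule conn_component[OF sym_E])
        show "{k1} \<inter> X = {}" using XX by blast
        show "{(k1, z1), (k1, z2), (k1, a1)} \<subseteq> {k1} \<times> X" using memX by blast
        show "E p k" if "(p, k) \<in> {(k1, z1), (k1, z2), (k1, a1)}" for p k
        proof -
          have "E k1 z1" "E k1 z2" "E k1 a1"
            using e1(2,9) e2(9) eq sympD[OF sym_E] by simp_all
          then show ?thesis using that by auto
        qed
      qed
      moreover have "card {(k1, z1), (k1, z2), (k1, a1)} = 3" using z12 za by simp
      ultimately show False by simp
    qed
    then show ?case by blast
  qed
qed

end

subsection \<open>Forcing along oriented paths\<close>

abbreviation adj :: "('a, 'b) pre_digraph \<Rightarrow> 'a \<Rightarrow> 'a \<Rightarrow> bool" where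
  "adj G u v \<equiv> u \<rightarrow>\<^bsub>G\<^esub> v"

definition induced_list :: "('a \<Rightarrow> 'a \<Rightarrow> bool) \<Rightarrow> 'a list \<Rightarrow> bool" where
  "induced_list E xs \<longleftrightarrow> xs \<noteq> [] \<and> distinct xs \<and>
     (\<forall>x\<in>set xs. \<forall>y\<in>set xs. E x y \<longleftrightarrow> next_in xs x y \<or> next_in xs y x)"

text \<open>The covered set is a parameter because the chains of a partial run cover only the
  vertices that are black so far.\<close>

definition induced_list_cover :: "('a \<Rightarrow> 'a \<Rightarrow> bool) \<Rightarrow> 'a set \<Rightarrow> 'a list set \<Rightarrow> bool" where
  "induced_list_cover E V L \<longleftrightarrow> finite L \<and> (\<forall>xs\<in>L. induced_list E xs) \<and>
     (\<forall>xs\<in>L. \<forall>ys\<in>L. xs \<noteq> ys \<longrightarrow> set xs \<inter> set ys = {}) \<and> \<Union> (set ` L) = V"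

lemma next_in_nth: "next_in xs x y \<longleftrightarrow> (\<exists>i. Suc i < length xs \<and> x = xs ! i \<and> y = xs ! Suc i)"
proof
  assume "next_in xs x y"
  then obtain as cs where "xs = as @ x # y # cs" unfolding next_in_def by blast
  then show "\<exists>i. Suc i < length xs \<and> x = xs ! i \<and> y = xs ! Suc i"
    by (intro exI[of _ "length as"]) (simp add: nth_append)
next
  assume "\<exists>i. Suc i < length xs \<and> x = xs ! i \<and> y = xs ! Suc i"
  then obtain i where i: "Suc i < length xs" "x = xs ! i" "y = xs ! Suc i" by blast
  then have "xs = take i xs @ x # y # drop (Suc (Suc i)) xs"
    by (simp add: Cons_nth_drop_Suc)
  then show "next_in xs x y" unfolding next_in_def by blast
qed

lemma before_nth:
  assumes "i < j" "j < length xs" shows "before xs (xs ! i) (xs ! j)"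
proof -
  have "xs = take j xs @ xs ! j # drop (Suc j) xs" using assms(2) by (rule id_take_nth_drop)
  moreover have "take j xs = take i (take j xs) @ take j xs ! i # drop (Suc i) (take j xs)"
    by (rule id_take_nth_drop) (use assms in simp)
  moreover have "take j xs ! i = xs ! i" using assms(1) by simp
  ultimately have "xs = take i (take j xs) @ xs ! i # drop (Suc i) (take j xs) @ xs ! j # drop (Suc j) xs"
    by (metis append.assoc append_Cons)
  then show ?thesis unfolding before_def by blast
qed

lemma induced_list_rev: "induced_list E (rev xs) \<longleftrightarrow> induced_list E xs"
  by (auto simp: induced_list_def)

lemma induced_list_successively:
  assumes "induced_list E xs" shows "successively E xs"
  unfolding successively_conv_nth
proof (intro allI impI)
  fix i assume i: "Suc i < length xs"
  then have "next_in xs (xs ! i) (xs ! Suc i)" unfolding next_in_nth by blast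
  then show "E (xs ! i) (xs ! Suc i)" using assms i by (simp add: induced_list_def)
qed

lemma induced_list_cover_walks:
  "induced_list_cover E V L \<Longrightarrow> disjoint_walks E V L"
  by (auto simp: induced_list_cover_def disjoint_walks_def induced_list_successively)
    (auto simp: induced_list_def)

lemma induced_list_cover_orient:
  assumes "induced_list_cover E V L"
  shows "induced_list_cover E V (orient \<sigma> ` L)"
proof -
  have ind: "induced_list E (orient \<sigma> xs) \<longleftrightarrow> induced_list E xs" for xs
    by (simp add: induced_list_rev orient_def)
  have "set xs \<inter> set ys = {}" if "xs \<in> L" "ys \<in> L" "orient \<sigma> xs \<noteq> orient \<sigma> ys" for xs ys
  proof -
    have "xs \<noteq> ys" using that(3) by blast
    then show ?thesis using assms that(1,2) unfolding induced_list_cover_def by blast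
  qed
  then show ?thesis
    using assms unfolding induced_list_cover_def
    by (simp only: ball_simps image_image set_orient ind finite_imageI) simp
qed

text \<open>Moves the directions into the lists: once every list is replaced by its oriented
  version, the trivial orientation \<open>\<lambda>_. True\<close> is free of deadlocks and forcing
  can run from head to last.\<close>

lemma (in block_cycle) oriented_cover_exists:
  assumes "induced_list_cover E V L"
  obtains \<sigma> where "\<And>D u. D \<subseteq> orient \<sigma> ` L \<Longrightarrow> \<not> deadlock E (\<lambda>_. True) D u"
proof -
  obtain \<sigma> where no: "\<And>D u. D \<subseteq> L \<Longrightarrow> \<not> deadlock E \<sigma> D u"
    using orientation_exists[OF induced_list_cover_walks[OF assms]] by blast
  have "\<not> deadlock E (\<lambda>_. True) D u" if D: "D \<subseteq> orient \<sigma> ` L" for D u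
  proof
    assume dl: "deadlock E (\<lambda>_. True) D u"
    obtain C where C: "C \<subseteq> L" "D = orient \<sigma> ` C" using D by (meson subset_imageE)
    have "deadlock E \<sigma> C (u \<circ> orient \<sigma>)"
      unfolding deadlock_def
    proof (intro conjI ballI)
      show "C \<noteq> {}" using dl C by (simp add: deadlock_def)
      fix xs assume xs: "xs \<in> C"
      then have xD: "orient \<sigma> xs \<in> D" using C by simp
      then show "(u \<circ> orient \<sigma>) xs \<in> set xs" using dl by (auto simp: deadlock_def)
      obtain ys w where ys: "ys \<in> D" "ys \<noteq> orient \<sigma> xs" "E (u (orient \<sigma> xs)) w"
        "before (orient (\<lambda>_. True) ys) (u ys) w"
        by (rule deadlock_step[OF dl xD])
      then obtain zs where "zs \<in> C" "ys = orient \<sigma> zs" using C by blast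
      moreover have "orient (\<lambda>_. True) ys = ys" by (simp add: orient_def)
      ultimately show "\<exists>ys\<in>C. ys \<noteq> xs \<and> (\<exists>w. E ((u \<circ> orient \<sigma>) xs) w \<and>
          before (orient \<sigma> ys) ((u \<circ> orient \<sigma>) ys) w)"
        using ys by auto
    qed
    then show False using no C(1) by blast
  qed
  then show thesis using that by blast
qed

section \<open>Running the forces along the lists\<close>

definition black :: "'a list set \<Rightarrow> ('a list \<Rightarrow> nat) \<Rightarrow> 'a set" where
  "black L n = (\<Union>xs\<in>L. set (take (n xs) xs))"

text \<open>The last black vertices of the unfinished paths are no deadlock, so one of them has no
  white neighbour on another path. On its own path, being induced, the next vertex is its only white
  neighbour.\<close>

lemma force_step:
  assumes L: "induced_list_cover (adj G) (verts G) L"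
    and no: "\<And>D u. D \<subseteq> L \<Longrightarrow> \<not> deadlock (adj G) (\<lambda>_. True) D u"
    and n: "\<And>xs. xs \<in> L \<Longrightarrow> 1 \<le> n xs \<and> n xs \<le> length xs"
    and ex: "\<exists>xs\<in>L. n xs < length xs"
  obtains xs where "xs \<in> L" "n xs < length xs"
    "forces G (black L n) (xs ! (n xs - 1)) (xs ! n xs)"
proof -
  have ind: "induced_list (adj G) xs" if "xs \<in> L" for xs
    using L that by (simp add: induced_list_cover_def)
  have dist: "distinct xs" if "xs \<in> L" for xs using ind[OF that] by (simp add: induced_list_def)
  have disj: "xs = ys" if "xs \<in> L" "ys \<in> L" "x \<in> set xs" "x \<in> set ys" for xs ys x
    using L that unfolding induced_list_cover_def by blast
  have cover: "\<Union> (set ` L) = verts G" using L by (simp add: induced_list_cover_def)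
  define D where "D = {xs \<in> L. n xs < length xs}"
  \<comment> \<open>The last black vertex; \<open>1 \<le> n xs\<close> makes the subtraction
    exact.\<close>
  define u where "u xs = xs ! (n xs - 1)" for xs
  have "D \<subseteq> L" "D \<noteq> {}" using ex by (auto simp: D_def)
  moreover have "u xs \<in> set xs" if "xs \<in> D" for xs
    using n[of xs] that by (auto simp: D_def u_def)
  ultimately have "\<exists>xs\<in>D. \<forall>ys\<in>D. ys \<noteq> xs \<longrightarrow> (\<forall>w. adj G (u xs) w \<longrightarrow> \<not> before ys (u ys) w)"
    using no[of D u] unfolding deadlock_def orient_def if_True by blast
  then obtain xs where xs: "xs \<in> D"
    and free: "\<And>ys w. ys \<in> D \<Longrightarrow> ys \<noteq> xs \<Longrightarrow> adj G (u xs) w \<Longrightarrow> \<not> before ys (u ys) w"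
    by blast
  have xL: "xs \<in> L" and nx: "n xs < length xs" using xs by (simp_all add: D_def)
  have n1: "1 \<le> n xs" using n[OF xL] by simp
  have black_index: "j < n ys" if ys: "ys \<in> L" "j < length ys" "ys ! j \<in> black L n" for ys j
  proof -
    obtain zs where zs: "zs \<in> L" "ys ! j \<in> set (take (n zs) zs)" using ys(3) by (auto simp: black_def)
    then have "zs = ys" using disj[of zs ys "ys ! j"] ys in_set_takeD[OF zs(2)] by simp
    then obtain i where "i < n ys" "i < length ys" "ys ! i = ys ! j"
      using zs(2) by (auto simp: in_set_conv_nth)
    then show ?thesis using dist[OF ys(1)] ys(2) by (simp add: nth_eq_iff_index_eq)
  qed
  let ?v = "xs ! n xs"
  have nextv: "next_in xs (u xs) ?v"
    unfolding next_in_nth u_def using n1 nx by (intro exI[of _ "n xs - 1"]) simp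
  have "{w \<in> verts G. adj G (u xs) w} - black L n = {?v}"
  proof (intro equalityI subsetI)
    fix w assume w: "w \<in> {w \<in> verts G. adj G (u xs) w} - black L n"
    then obtain ys where ys: "ys \<in> L" "w \<in> set ys" using cover by blast
    then obtain j where j: "j < length ys" "w = ys ! j" by (auto simp: in_set_conv_nth)
    have "\<not> j < n ys"
    proof
      assume "j < n ys"
      then have "w \<in> set (take (n ys) ys)" using j by (auto simp: in_set_conv_nth)
      then show False using w ys(1) by (auto simp: black_def)
    qed
    then have nj: "n ys \<le> j" by simp
    have n1y: "1 \<le> n ys" using n[OF ys(1)] by simp
    have "before ys (u ys) w"
      unfolding j(2) u_def by (rule before_nth) (use nj n1y j in auto)
    moreover have "ys \<in> D" using ys(1) nj j by (simp add: D_def)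
    ultimately have yx: "ys = xs" using free w by blast
    have "u xs \<in> set xs" using n1 nx by (simp add: u_def)
    then have "next_in xs (u xs) w \<or> next_in xs w (u xs)"
      using ind[OF xL] w ys(2) yx unfolding induced_list_def by blast
    then have "next_in xs (u xs) w"
      using before_asym[OF dist[OF xL]] \<open>before ys (u ys) w\<close> next_in_before yx by metis
    then obtain i where i: "Suc i < length xs" "xs ! (n xs - 1) = xs ! i" "w = xs ! Suc i"
      unfolding next_in_nth u_def by blast
    then have "n xs - 1 = i" using dist[OF xL] nx by (simp add: nth_eq_iff_index_eq)
    then have "Suc i = n xs" using n1 by simp
    then show "w \<in> {?v}" using i(3) by simp
  next
    fix w assume "w \<in> {?v}"
    then have w: "w = ?v" by simp
    have m: "?v \<in> set xs" "u xs \<in> set xs" using n1 nx by (simp_all add: u_def)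
    then have "?v \<in> verts G" using cover xL by blast
    moreover have "adj G (u xs) ?v" using ind[OF xL] nextv m unfolding induced_list_def by blast
    moreover have "?v \<notin> black L n" using black_index[OF xL nx] by auto
    ultimately show "w \<in> {w \<in> verts G. adj G (u xs) w} - black L n" using w by simp
  qed
  moreover have "u xs \<in> black L n"
  proof -
    have "u xs \<in> set (take (n xs) xs)"
      unfolding in_set_conv_nth u_def using n1 nx by (intro exI[of _ "n xs - 1"]) simp
    then show ?thesis using xL by (auto simp: black_def)
  qed
  ultimately show thesis using that[OF xL nx] by (simp add: forces_def u_def)
qed

text \<open>Stated for every state \<open>n\<close> to allow induction on the number of white
  vertices. The condition \<open>n xs \<le> Suc i\<close> selects the steps whose target is still
  white.\<close>

lemma forcing_run:
  assumes L: "induced_list_cover (adj G) (verts G) L"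
    and no: "\<And>D u. D \<subseteq> L \<Longrightarrow> \<not> deadlock (adj G) (\<lambda>_. True) D u"
    and n: "\<And>xs. xs \<in> L \<Longrightarrow> 1 \<le> n xs \<and> n xs \<le> length xs"
  shows "\<exists>fs. chronological_list G (black L n) fs \<and>
    set fs = {(xs ! i, xs ! Suc i) | xs i. xs \<in> L \<and> n xs \<le> Suc i \<and> Suc i < length xs}"
  using n
proof (induction "\<Sum>xs\<in>L. length xs - n xs" arbitrary: n rule: less_induct)
  case less
  have finL: "finite L" using L by (simp add: induced_list_cover_def)
  show ?case
  proof (cases "\<exists>xs\<in>L. n xs < length xs")
    case False
    then have eq: "n xs = length xs" if "xs \<in> L" for xs using less.prems[OF that] that by force
    then have "black L n = verts G"
      using L by (simp add: black_def induced_list_cover_def)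
    moreover have "{(xs ! i, xs ! Suc i) | xs i. xs \<in> L \<and> n xs \<le> Suc i \<and> Suc i < length xs} = {}"
      using eq by fastforce
    ultimately show ?thesis by (intro exI[of _ "[]"]) simp
  next
    case True
    obtain xs where xs: "xs \<in> L" "n xs < length xs"
      and f: "forces G (black L n) (xs ! (n xs - 1)) (xs ! n xs)"
      using force_step[OF L no less.prems True] by blast
    define m where "m = n(xs := Suc (n xs))"
    have m: "1 \<le> m ys \<and> m ys \<le> length ys" if "ys \<in> L" for ys
      using less.prems[OF that] xs by (simp add: m_def)
    have "(\<Sum>xs\<in>L. length xs - m xs) < (\<Sum>xs\<in>L. length xs - n xs)"
      by (rule sum_strict_mono_ex1[OF finL])
        (use xs in \<open>auto simp: m_def intro!: bexI[of _ xs]\<close>)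
    from less.hyps[OF this m] obtain fs where fs: "chronological_list G (black L m) fs"
      "set fs = {(ys ! i, ys ! Suc i) | ys i. ys \<in> L \<and> m ys \<le> Suc i \<and> Suc i < length ys}"
      by blast
    have "black L m = insert (xs ! n xs) (black L n)"
    proof -
      have t: "set (take (m ys) ys) = (if ys = xs then insert (xs ! n xs) (set (take (n ys) ys)) else set (take (n ys) ys))" for ys
        using xs by (simp add: m_def take_Suc_conv_app_nth)
      show ?thesis unfolding black_def t using xs(1) by (auto split: if_splits)
    qed
    then have "chronological_list G (black L n) ((xs ! (n xs - 1), xs ! n xs) # fs)"
      using f fs(1) by simp
    moreover have "set ((xs ! (n xs - 1), xs ! n xs) # fs) =
        {(ys ! i, ys ! Suc i) | ys i. ys \<in> L \<and> n ys \<le> Suc i \<and> Suc i < length ys}" (is "?l = ?r")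
    proof (rule set_eqI, rule iffI)
      fix p assume "p \<in> ?l"
      then consider "p = (xs ! (n xs - 1), xs ! n xs)"
        | ys i where "p = (ys ! i, ys ! Suc i)" "ys \<in> L" "m ys \<le> Suc i" "Suc i < length ys"
        using fs(2) by auto
      then show "p \<in> ?r"
      proof cases
        case 1
        then show ?thesis
          using xs less.prems[OF xs(1)] by (intro CollectI exI[of _ xs] exI[of _ "n xs - 1"]) simp
      next
        case (2 ys i)
        then have "n ys \<le> Suc i" by (simp add: m_def split: if_splits)
        then show ?thesis using 2 by blast
      qed
    next
      fix p assume "p \<in> ?r"
      then obtain ys i where p: "p = (ys ! i, ys ! Suc i)" "ys \<in> L" "n ys \<le> Suc i" "Suc i < length ys"
        by blast
      show "p \<in> ?l"
      proof (cases "ys = xs \<and> n xs = Suc i")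
        case False
        then have "m ys \<le> Suc i" using p(3) by (auto simp: m_def)
        then have "p \<in> set fs" unfolding fs(2) using p by blast
        then show ?thesis by simp
      qed (use p in simp)
    qed
    ultimately show ?thesis by blast
  qed
qed

lemma forcing_run_from_heads:
  assumes L: "induced_list_cover (adj G) (verts G) L"
    and no: "\<And>D u. D \<subseteq> L \<Longrightarrow> \<not> deadlock (adj G) (\<lambda>_. True) D u"
  obtains fs where "chronological_list G (hd ` L) fs"
    "\<And>x y. (x, y) \<in> set fs \<longleftrightarrow> (\<exists>xs\<in>L. next_in xs x y)"
proof -
  have ne: "xs \<noteq> []" if "xs \<in> L" for xs
    using L that by (simp add: induced_list_cover_def induced_list_def)
  have "\<exists>fs. chronological_list G (black L (\<lambda>_. 1)) fs \<and>
    set fs = {(xs ! i, xs ! Suc i) | xs i. xs \<in> L \<and> 1 \<le> Suc i \<and> Suc i < length xs}"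
    by (rule forcing_run[OF L no]) (use ne in \<open>auto simp: Suc_le_eq\<close>)
  then obtain fs where fs: "chronological_list G (black L (\<lambda>_. 1)) fs"
    "set fs = {(xs ! i, xs ! Suc i) | xs i. xs \<in> L \<and> 1 \<le> Suc i \<and> Suc i < length xs}" by blast
  have "set (take 1 xs) = {hd xs}" if "xs \<in> L" for xs
    using ne[OF that] by (cases xs) simp_all
  then have "black L (\<lambda>_. 1) = hd ` L" by (auto simp: black_def)
  moreover have "(x, y) \<in> set fs \<longleftrightarrow> (\<exists>xs\<in>L. next_in xs x y)" for x y
    unfolding fs(2) next_in_nth by auto
  ultimately show thesis using that fs(1) by simp
qed

section \<open>Maximal forcing chains of such a run\<close>

text \<open>Consecutive forces share a vertex, so disjointness puts them on one path, and
  distinctness leaves a single place on it where the chain can be extended to the left.\<close>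

lemma chain_in_path:
  assumes L: "induced_list_cover E (verts G) L"
    and fs: "\<And>x y. (x, y) \<in> set fs \<longleftrightarrow> (\<exists>xs\<in>L. next_in xs x y)"
    and chain: "forcing_chain G fs vs"
  shows "\<exists>xs\<in>L. sublist vs xs"
  using chain
proof (induction vs rule: induct_list012)
  case 1
  then show ?case by (simp add: forcing_chain_def)
next
  case (2 v)
  then have "v \<in> \<Union> (set ` L)"
    using L by (simp add: forcing_chain_def induced_list_cover_def)
  then obtain xs where "xs \<in> L" "v \<in> set xs" by blast
  moreover from this obtain as bs where "xs = as @ [v] @ bs" by (auto dest: split_list)
  ultimately show ?case unfolding sublist_def by blast
next
  case (3 v w vs)
  have "forcing_chain G fs (w # vs)" using 3(3) by (simp add: forcing_chain_def)
  then obtain xs ps ss where xs: "xs \<in> L" "xs = ps @ (w # vs) @ ss" using 3(2) unfolding sublist_def by blast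
  have "(v, w) \<in> set fs" using 3(3) by (simp add: forcing_chain_def)
  then obtain ys as cs where ys: "ys \<in> L" "ys = as @ v # w # cs" using fs unfolding next_in_def by blast
  have "w \<in> set xs \<inter> set ys" using xs(2) ys(2) by simp
  then have "xs = ys" using L xs(1) ys(1) unfolding induced_list_cover_def by blast
  moreover have "distinct xs" using L xs(1) by (simp add: induced_list_cover_def induced_list_def)
  ultimately have d: "distinct (ps @ w # (vs @ ss))" and "ps @ w # (vs @ ss) = (as @ [v]) @ w # cs"
    using xs(2) ys(2) by simp_all
  moreover have "w \<notin> set ps" "w \<notin> set (vs @ ss)" using d by auto
  ultimately have "ps = as @ [v]" using append_Cons_eq_iff[of w ps "vs @ ss" "as @ [v]" cs] by simp
  then have "xs = as @ (v # w # vs) @ ss" using xs(2) by simp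
  then show ?case using xs(1) unfolding sublist_def by blast
qed

lemma path_is_chain:
  assumes L: "induced_list_cover E (verts G) L"
    and fs: "\<And>x y. (x, y) \<in> set fs \<longleftrightarrow> (\<exists>xs\<in>L. next_in xs x y)"
    and xs: "xs \<in> L"
  shows "forcing_chain G fs xs"
  unfolding forcing_chain_def
proof (intro conjI)
  show "xs \<noteq> []" using L xs by (simp add: induced_list_cover_def induced_list_def)
  show "set xs \<subseteq> verts G" using L xs unfolding induced_list_cover_def by blast
  show "successively (\<lambda>u v. (u, v) \<in> set fs) xs"
    unfolding successively_conv_nth fs next_in_nth using xs by blast
qed

text \<open>Each path is a chain and each chain is a contiguous part of a path. A chain that
  contains a whole path lies on a path sharing vertices with it, hence on that path itself.\<close>

lemma maximal_chains:
  assumes L: "induced_list_cover E (verts G) L"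
    and fs: "\<And>x y. (x, y) \<in> set fs \<longleftrightarrow> (\<exists>xs\<in>L. next_in xs x y)"
  shows "maximal_forcing_chain G fs vs \<longleftrightarrow> vs \<in> L"
proof
  assume m: "maximal_forcing_chain G fs vs"
  then obtain xs where xs: "xs \<in> L" "sublist vs xs"
    using chain_in_path[OF L fs] unfolding maximal_forcing_chain_def by blast
  then have "\<not> strict_sublist vs xs"
    using m path_is_chain[OF L fs xs(1)] unfolding maximal_forcing_chain_def by blast
  then have "vs = xs" using xs(2) by (simp add: strict_sublist_def)
  then show "vs \<in> L" using xs(1) by simp
next
  assume vs: "vs \<in> L"
  have "\<not> strict_sublist vs ws" if wsc: "forcing_chain G fs ws" for ws
  proof
    assume str: "strict_sublist vs ws"
    then have s: "sublist vs ws" by (simp add: strict_sublist_def)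
    obtain xs where xs: "xs \<in> L" "sublist ws xs" using chain_in_path[OF L fs wsc] by blast
    have "set vs \<subseteq> set xs" using set_mono_sublist[OF s] set_mono_sublist[OF xs(2)] by simp
    moreover have "vs \<noteq> []" using L vs by (simp add: induced_list_cover_def induced_list_def)
    ultimately have "set vs \<inter> set xs \<noteq> {}" by (simp add: Int_absorb2)
    then have "vs = xs" using L vs xs(1) unfolding induced_list_cover_def by blast
    then have "vs = ws" using s xs(2) sublist_order.order.antisym by blast
    then show False using str by (simp add: strict_sublist_def)
  qed
  then show "maximal_forcing_chain G fs vs"
    using path_is_chain[OF L fs vs] unfolding maximal_forcing_chain_def by blast
qed

section \<open>Path covers from arbitrary runs\<close>

lemma next_in_snoc: "next_in (xs @ [v]) x y \<longleftrightarrow> next_in xs x y \<or> xs \<noteq> [] \<and> x = last xs \<and> y = v"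
proof
  assume "next_in (xs @ [v]) x y"
  then obtain as cs where eq: "xs @ [v] = as @ x # y # cs" unfolding next_in_def by blast
  show "next_in xs x y \<or> xs \<noteq> [] \<and> x = last xs \<and> y = v"
  proof (cases cs rule: rev_cases)
    case Nil
    then have "xs @ [v] = (as @ [x]) @ [y]" using eq by simp
    then have "xs = as @ [x]" "v = y" by (simp_all only: append1_eq_conv)
    then show ?thesis by simp
  next
    case (snoc ds d)
    then have "xs @ [v] = (as @ x # y # ds) @ [d]" using eq by simp
    then have "xs = as @ x # y # ds" by (simp only: append1_eq_conv)
    then show ?thesis unfolding next_in_def by blast
  qed
next
  assume "next_in xs x y \<or> xs \<noteq> [] \<and> x = last xs \<and> y = v"
  then show "next_in (xs @ [v]) x y"
  proof
    assume "next_in xs x y"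
    then show ?thesis unfolding next_in_def by fastforce
  next
    assume *: "xs \<noteq> [] \<and> x = last xs \<and> y = v"
    then have "xs @ [v] = butlast xs @ x # y # []" by simp
    then show ?thesis unfolding next_in_def by blast
  qed
qed

text \<open>Only the last vertex of a chain of forces can have a white neighbour, which keeps the chain
  induced when it grows.\<close>

lemma black_set_chains:
  assumes sym: "symp (adj G)" and irr: "\<And>x. \<not> adj G x x" and fin: "finite Z"
    and run: "(colour_change G)\<^sup>*\<^sup>* Z B"
  shows "\<exists>L. induced_list_cover (adj G) B L \<and> card L = card Z \<and>
     (\<forall>xs\<in>L. \<forall>x\<in>set (butlast xs). {w \<in> verts G. adj G x w} \<subseteq> B)"
  using run
proof (induction rule: rtranclp_induct)
  case base
  let ?L = "(\<lambda>z. [z]) ` Z"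
  have "\<not> next_in [z] x y" for z x y :: 'a by (simp add: next_in_nth)
  then have "induced_list_cover (adj G) Z ?L"
    using fin irr by (auto simp: induced_list_cover_def induced_list_def)
  moreover have "card ?L = card Z" by (rule card_image) (simp add: inj_on_def)
  ultimately show ?case by (intro exI[of _ ?L]) simp
next
  case (step B C)
  then obtain L where L: "induced_list_cover (adj G) B L" "card L = card Z"
    and blk: "\<And>xs x. xs \<in> L \<Longrightarrow> x \<in> set (butlast xs) \<Longrightarrow> {w \<in> verts G. adj G x w} \<subseteq> B" by blast
  obtain u v where f: "u \<in> B" "{w \<in> verts G. adj G u w} - B = {v}" and C: "C = insert v B"
    using step(2) unfolding colour_change_def forces_def by blast
  have v: "v \<notin> B" "v \<in> verts G" "adj G u v" using f(2) by auto
  obtain xs where xs: "xs \<in> L" "u \<in> set xs" using L(1) f(1) unfolding induced_list_cover_def by blast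
  have ne: "xs \<noteq> []" using xs(2) by auto
  have split: "set xs = insert (last xs) (set (butlast xs))"
    using ne by (metis append_butlast_last_id set_append list.set(1,2) Un_insert_right Un_empty_right)
  have blk': "\<not> adj G x v" if "x \<in> set (butlast xs)" for x using blk[OF xs(1) that] v by blast
  have u: "u = last xs" using blk' split xs(2) v(3) by blast
  have ind: "induced_list (adj G) ys" if "ys \<in> L" for ys using L(1) that by (simp add: induced_list_cover_def)
  have LB: "\<Union> (set ` L) = B" using L(1) by (simp add: induced_list_cover_def)
  have vn: "v \<notin> set ys" if "ys \<in> L" for ys using that LB v(1) by blast
  have finL: "finite L" using L(1) by (simp add: induced_list_cover_def)
  \<comment> \<open>The forcing vertex ends its chain \<open>xs\<close>, so \<open>v\<close> extends
    this chain, the other chains are kept, and their number stays \<open>card Z\<close>.\<close>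
  let ?xs = "xs @ [v]"
  let ?L = "insert ?xs (L - {xs})"
  have xv: "adj G x v \<longleftrightarrow> x = last xs" if "x \<in> set xs" for x
    using that split blk' u v(3) by blast
  have nv: "\<not> next_in xs x v \<and> \<not> next_in xs v x" for x
    using before_mem[OF next_in_before, of xs] vn[OF xs(1)] by metis
  have vl: "v \<noteq> last xs" using vn[OF xs(1)] ne last_in_set[of xs] by metis
  have "induced_list (adj G) ?xs"
    unfolding induced_list_def
  proof (intro conjI ballI)
    show "?xs \<noteq> []" by simp
    show "distinct ?xs" using ind[OF xs(1)] vn[OF xs(1)] by (simp add: induced_list_def)
    fix x y assume xy: "x \<in> set ?xs" "y \<in> set ?xs"
    show "adj G x y \<longleftrightarrow> next_in ?xs x y \<or> next_in ?xs y x"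
    proof (cases "x = v")
      case True
      show ?thesis
      proof (cases "y = v")
        case True
        then show ?thesis using \<open>x = v\<close> irr[of v] nv vl by (simp add: next_in_snoc)
      next
        case False
        then have "y \<in> set xs" using xy by simp
        then have "adj G v y \<longleftrightarrow> y = last xs" using xv sympD[OF sym] by blast
        then show ?thesis using True False nv vl ne by (auto simp: next_in_snoc)
      qed
    next
      case False
      then have x: "x \<in> set xs" using xy by simp
      show ?thesis
      proof (cases "y = v")
        case True
        then show ?thesis using False nv vl ne xv[OF x] by (auto simp: next_in_snoc)
      next
        case False
        then have y: "y \<in> set xs" using xy by simp
        then show ?thesis using False \<open>x \<noteq> v\<close> ind[OF xs(1)] x by (simp add: next_in_snoc induced_list_def)
      qed
    qed
  qed
  then have ind': "\<forall>ys\<in>?L. induced_list (adj G) ys" using ind by simp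
  have disj: "set ys \<inter> set zs = {}" if "ys \<in> L" "zs \<in> L" "ys \<noteq> zs" for ys zs
    using L(1) that unfolding induced_list_cover_def by blast
  have d1: "set ?xs \<inter> set ys = {}" if "ys \<in> L - {xs}" for ys
    using disj[OF xs(1), of ys] that vn[of ys] by auto
  have "\<forall>ys\<in>?L. \<forall>zs\<in>?L. ys \<noteq> zs \<longrightarrow> set ys \<inter> set zs = {}"
  proof (intro ballI impI)
    fix ys zs assume *: "ys \<in> ?L" "zs \<in> ?L" "ys \<noteq> zs"
    show "set ys \<inter> set zs = {}"
    proof (cases "ys = ?xs")
      case True
      then show ?thesis using * d1[of zs] by simp
    next
      case False
      show ?thesis
      proof (cases "zs = ?xs")
        case True
        then show ?thesis using * d1[of ys] by (simp add: Int_commute)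
      next
        case False
        then show ?thesis using * \<open>ys \<noteq> ?xs\<close> disj[of ys zs] by simp
      qed
    qed
  qed
  moreover have "\<Union> (set ` ?L) = C"
  proof -
    have "L = insert xs (L - {xs})" using xs(1) by blast
    then have "B = set xs \<union> \<Union> (set ` (L - {xs}))" using LB by (metis Union_insert image_insert)
    then show ?thesis unfolding C by auto
  qed
  ultimately have "induced_list_cover (adj G) C ?L"
    using ind' finL by (simp add: induced_list_cover_def)
  moreover have "card ?L = card Z"
  proof -
    have "?xs \<notin> L" using vn[of ?xs] by auto
    then have "card ?L = Suc (card (L - {xs}))" using finL by simp
    also have "\<dots> = card L" using card_Suc_Diff1[OF finL xs(1)] .
    finally show ?thesis using L(2) by simp
  qed
  moreover have "\<forall>ys\<in>?L. \<forall>x\<in>set (butlast ys). {w \<in> verts G. adj G x w} \<subseteq> C"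
  proof (intro ballI)
    fix ys x assume ys: "ys \<in> ?L" "x \<in> set (butlast ys)"
    show "{w \<in> verts G. adj G x w} \<subseteq> C"
    proof (cases "ys = ?xs")
      \<comment> \<open>Only \<open>u\<close> newly stops being a last vertex, and its one white
        neighbour \<open>v\<close> has just become black.\<close>
      case True
      then have "x \<in> set xs" using ys(2) by simp
      then consider "x = u" | "x \<in> set (butlast xs)" using split u by blast
      then show ?thesis using f(2) blk[OF xs(1)] C by cases blast+
    next
      case False
      then have "{w \<in> verts G. adj G x w} \<subseteq> B" using ys by (intro blk) auto
      then show ?thesis using C by blast
    qed
  qed
  ultimately show ?case by blast
qed

subsection \<open>From block-cycle graphs to the degree condition\<close>

text \<open>\<open>A\<close> collects the successors of \<open>x\<close> on the cycle and
  \<open>B\<close> its predecessors. Each has at most one element since entries are distinct and the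
  cyclic shift \<open>Suc i mod ?n\<close> is injective.\<close>

lemma cycle_graph_degree:
  assumes "is_cycle_graph H"
  shows "\<exists>S. finite S \<and> card S \<le> 2 \<and> {y. adj H x y} \<subseteq> S"
proof -
  obtain xs where xs: "distinct xs" "length xs \<ge> 3"
    and ends: "arcs_ends H = (\<Union>i<length xs. {(xs ! i, xs ! (Suc i mod length xs)),
                                    (xs ! (Suc i mod length xs), xs ! i)})"
    using assms unfolding is_cycle_graph_def by blast
  let ?n = "length xs"
  have n0: "0 < ?n" using xs(2) by linarith
  define A where "A = {xs ! (Suc i mod ?n) | i. i < ?n \<and> xs ! i = x}"
  define B where "B = {xs ! i | i. i < ?n \<and> xs ! (Suc i mod ?n) = x}"
  have at_most1: "finite S \<and> card S \<le> 1" if "\<And>y z. y \<in> S \<Longrightarrow> z \<in> S \<Longrightarrow> y = z" for S :: "'a set"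
  proof (cases "S = {}")
    case False
    then obtain s where "s \<in> S" by blast
    then have "S = {s}" using that by blast
    then show ?thesis by simp
  qed simp
  have idx: "i = j" if "i < ?n" "j < ?n" "xs ! i = xs ! j" for i j
    using xs(1) that by (simp add: nth_eq_iff_index_eq)
  have "finite A \<and> card A \<le> 1"
    by (rule at_most1) (use idx in \<open>auto simp: A_def\<close>)
  moreover have suc: "i = j" if "i < ?n" "j < ?n" "Suc i mod ?n = Suc j mod ?n" for i j
    using that by (auto simp: mod_Suc split: if_splits)
  have "finite B \<and> card B \<le> 1"
  proof (rule at_most1)
    fix y z assume "y \<in> B" "z \<in> B"
    then obtain i j where ij: "i < ?n" "j < ?n" "xs ! (Suc i mod ?n) = x" "xs ! (Suc j mod ?n) = x"
      and yz: "y = xs ! i" "z = xs ! j" unfolding B_def by blast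
    have "Suc i mod ?n = Suc j mod ?n" by (rule idx) (use n0 ij in simp_all)
    then have "i = j" by (rule suc[OF ij(1,2)])
    then show "y = z" using yz by simp
  qed
  moreover have "{y. adj H x y} \<subseteq> A \<union> B"
    unfolding ends A_def B_def by auto
  ultimately show ?thesis
    using card_Un_le[of A B] by (intro exI[of _ "A \<union> B"]) auto
qed

lemma edge_graph_degree:
  assumes "is_edge_graph H"
  shows "\<exists>S. finite S \<and> card S \<le> 2 \<and> {y. adj H x y} \<subseteq> S"
proof -
  obtain u v where uv: "arcs_ends H = {(u, v), (v, u)}" using assms unfolding is_edge_graph_def by blast
  have "{y. adj H x y} \<subseteq> {u, v}" unfolding uv by auto
  moreover have "card {u, v} \<le> 2" by (simp add: card_insert_if)
  ultimately show ?thesis by (intro exI[of _ "{u, v}"]) simp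
qed

lemma adj_induce: "adj (G \<restriction> W) u v \<longleftrightarrow> adj G u v \<and> u \<in> W \<and> v \<in> W"
  unfolding arcs_ends_conv by auto

text \<open>Lets induced subgraphs be handled through their vertex sets, as in the choice of a
  maximal non-separable one.\<close>

lemma induced_subgraph_eq_induce:
  assumes "induced_subgraph H G" shows "H = G \<restriction> verts H"
proof -
  have "tail H = tail G" "head H = head G"
    using assms by (auto simp: induced_subgraph_def subgraph_def compatible_def)
  moreover have "arcs H = {e \<in> arcs G. tail G e \<in> verts H \<and> head G e \<in> verts H}"
    using assms by (simp add: induced_subgraph_def)
  ultimately show ?thesis by (intro pre_digraph.equality) simp_all
qed

lemma adj_induced_subgraph:
  assumes "induced_subgraph H G"
  shows "adj H u v \<longleftrightarrow> adj G u v \<and> u \<in> verts H \<and> v \<in> verts H"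
  by (subst induced_subgraph_eq_induce[OF assms]) (rule adj_induce)

context graph
begin

lemma linked_reachable:
  assumes "linked (adj G) W u v" "u \<in> W"
  shows "u \<rightarrow>\<^sup>*\<^bsub>G \<restriction> W\<^esub> v"
proof -
  interpret H: wf_digraph "G \<restriction> W" by (rule wellformed_induce_subgraph)
  show ?thesis
    using assms(1) unfolding linked_def
  proof (induction rule: rtranclp_induct)
    case base
    show ?case by (rule H.reachable_refl) (simp add: assms(2))
  next
    case (step y z)
    have "adj (G \<restriction> W) y z" using step.hyps(2) by (simp add: adj_induce)
    with step.IH show ?case by (rule H.reachable_adj_trans)
  qed
qed

text \<open>\<open>cut_vertex\<close> compares numbers of components, so connectedness is turned
  into a number: one, or zero for the empty set, which arises when the only vertex of a singleton is
  deleted.\<close>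

lemma conn_sccs_verts:
  assumes "conn (adj G) W"
  shows "pre_digraph.sccs_verts (G \<restriction> W) = (if W = {} then {} else {W})"
proof -
  interpret H: wf_digraph "G \<restriction> W" by (rule wellformed_induce_subgraph)
  have "H.scc_of u = W" if "u \<in> W" for u
  proof (intro equalityI subsetI)
    fix v assume "v \<in> H.scc_of u"
    then show "v \<in> W" using H.reachable_in_verts(2)[of u v] by (simp add: H.scc_of_def)
  next
    fix v assume "v \<in> W"
    then show "v \<in> H.scc_of u"
      using that assms linked_reachable by (simp add: H.scc_of_def conn_def)
  qed
  then show ?thesis by (auto simp: H.sccs_verts_conv_scc_of)
qed

lemma biconnected_non_separable:
  assumes W: "W \<subseteq> verts G" "W \<noteq> {}" "conn (adj G) W" "\<And>v. v \<in> W \<Longrightarrow> conn (adj G) (W - {v})"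
  shows "non_separable (G \<restriction> W)"
proof -
  interpret H: wf_digraph "G \<restriction> W" by (rule wellformed_induce_subgraph)
  have "u \<rightarrow>\<^sup>*\<^bsub>G \<restriction> W\<^esub> v" if "u \<in> W" "v \<in> W" for u v
    using W(3) that linked_reachable by (simp add: conn_def)
  then have "Digraph_Component.connected (G \<restriction> W)"
    using W(2) H.reachable_mk_symmetricI
    by (simp add: Digraph_Component.connected_def strongly_connected_def)
  moreover have "\<not> cut_vertex (G \<restriction> W) v" for v
  proof
    assume c: "cut_vertex (G \<restriction> W) v"
    then have v: "v \<in> W" by (simp add: cut_vertex_def)
    have "pre_digraph.del_vert (G \<restriction> W) v = G \<restriction> (W - {v})"
      by (rule pre_digraph.equality) (auto simp: pre_digraph.del_vert_def induce_subgraph_def)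
    then show False
      using c conn_sccs_verts[OF W(3)] conn_sccs_verts[OF W(4)[OF v]] W(2)
      by (simp add: cut_vertex_def split: if_splits)
  qed
  ultimately show ?thesis by (simp add: non_separable_def)
qed

lemma non_separable_in_block:
  assumes "W \<subseteq> verts G" "non_separable (G \<restriction> W)"
  obtains B where "is_block B G" "W \<subseteq> verts B"
proof -
  let ?S = "{X. W \<subseteq> X \<and> X \<subseteq> verts G \<and> non_separable (G \<restriction> X)}"
  have "finite ?S" by (rule finite_subset[of _ "Pow (verts G)"]) auto
  moreover have "W \<in> ?S" using assms by simp
  ultimately have "\<exists>X\<in>?S. \<forall>Y\<in>?S. X \<subseteq> Y \<longrightarrow> X = Y"
    by (intro finite_has_maximal) auto
  then obtain X where X: "X \<in> ?S" and mx: "\<forall>Y\<in>?S. X \<subseteq> Y \<longrightarrow> X = Y" by (rule bexE)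
  have "is_block (G \<restriction> X) G"
    unfolding is_block_def
  proof (intro conjI notI)
    show "induced_subgraph (G \<restriction> X) G" using X by (intro induced_induce) simp
    show "non_separable (G \<restriction> X)" using X by simp
    assume "\<exists>B'. induced_subgraph B' G \<and> non_separable B' \<and> verts (G \<restriction> X) \<subset> verts B'"
    then obtain B' where B': "induced_subgraph B' G" "non_separable B'" "X \<subset> verts B'" by auto
    have "non_separable (G \<restriction> verts B')" using B' induced_subgraph_eq_induce by metis
    moreover have "verts B' \<subseteq> verts G" using B'(1) by (auto simp: induced_subgraph_def subgraph_def)
    ultimately have "verts B' \<in> ?S" using X B'(3) by blast
    then have "X = verts B'" using mx B'(3) by blast
    then show False using B'(3) by blast
  qed
  moreover have "W \<subseteq> verts (G \<restriction> X)" using X by simp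
  ultimately show thesis by (rule that)
qed

text \<open>A biconnected set is non-separable and so lies in a block. The block has degrees at most
  two, and passing to a subset of its vertices does not increase them.\<close>

lemma block_cycle_graph_is_block_cycle:
  assumes "block_cycle_graph G"
  shows "block_cycle (adj G) (verts G)"
proof
  show "finite (verts G)" by simp
  show "symp (adj G)" using sym_arcs by (auto simp: symmetric_def sym_def symp_def)
  show "\<not> adj G x x" for x using adj_not_same by blast
next
  fix W x
  assume W: "W \<subseteq> verts G" "conn (adj G) W" "\<And>v. v \<in> W \<Longrightarrow> conn (adj G) (W - {v})" "x \<in> W"
  have "non_separable (G \<restriction> W)" by (rule biconnected_non_separable) (use W in auto)
  then obtain B where B: "is_block B G" "W \<subseteq> verts B" by (rule non_separable_in_block[OF W(1)])
  obtain S where S: "finite S" "card S \<le> 2" "{y. adj B x y} \<subseteq> S"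
    using assms B(1) edge_graph_degree cycle_graph_degree unfolding block_cycle_graph_def by metis
  have "induced_subgraph B G" using B(1) by (simp add: is_block_def)
  then have "{y \<in> W. adj G x y} \<subseteq> {y. adj B x y}"
    using adj_induced_subgraph[of B G] W(4) B(2) by blast
  then have "card {y \<in> W. adj G x y} \<le> card S" using S(1,3) by (intro card_mono) auto
  then show "card {y \<in> W. adj G x y} \<le> 2" using S(2) by simp
qed

end

subsection \<open>Path covers and zero forcing sets\<close>

lemma path_order_iff:
  "path_order H xs \<longleftrightarrow> xs \<noteq> [] \<and> distinct xs \<and> verts H = set xs \<and>
     arcs_ends H = {(x, y). next_in xs x y \<or> next_in xs y x}"
proof -
  have "(\<Union>i<length xs - 1. {(xs ! i, xs ! Suc i), (xs ! Suc i, xs ! i)}) =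
      {(x, y). next_in xs x y \<or> next_in xs y x}"
    unfolding next_in_nth by (auto simp: less_diff_conv)
  then show ?thesis by (simp add: path_order_def)
qed

lemma path_order_rev: "path_order H (rev xs) \<longleftrightarrow> path_order H xs"
  unfolding path_order_iff by auto

lemma path_order_induced_list:
  assumes "induced_subgraph P G" "path_order P xs"
  shows "induced_list (adj G) xs"
proof -
  have "adj P x y \<longleftrightarrow> next_in xs x y \<or> next_in xs y x" for x y
    using assms(2) by (simp add: path_order_iff)
  then show ?thesis
    using assms(2) adj_induced_subgraph[OF assms(1)] unfolding induced_list_def path_order_iff
    by (metis)
qed

lemma induced_list_path_order:
  assumes "induced_list (adj G) xs"
  shows "path_order (G \<restriction> set xs) xs"
proof -
  have "arcs_ends (G \<restriction> set xs) = {(x, y). next_in xs x y \<or> next_in xs y x}"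
  proof (rule set_eqI)
    fix p :: "'a \<times> 'a"
    obtain x y where p: "p = (x, y)" by (cases p)
    have "adj (G \<restriction> set xs) x y \<longleftrightarrow> next_in xs x y \<or> next_in xs y x"
      unfolding adj_induce using assms before_mem[OF next_in_before, of xs] unfolding induced_list_def by blast
    then show "p \<in> arcs_ends (G \<restriction> set xs) \<longleftrightarrow> p \<in> {(x, y). next_in xs x y \<or> next_in xs y x}"
      using p by simp
  qed
  then show ?thesis using assms by (simp add: path_order_iff induced_list_def)
qed

lemma path_cover_lists:
  assumes "finite (verts G)" "path_cover G \<P>"
  obtains f where "\<And>P. P \<in> \<P> \<Longrightarrow> path_order P (f P)" "inj_on f \<P>"
    "induced_list_cover (adj G) (verts G) (f ` \<P>)"
proof -
  have ind: "induced_subgraph P G" "\<exists>xs. path_order P xs" if "P \<in> \<P>" for P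
    using assms that by (auto simp: path_cover_def induced_path_def)
  have disj: "verts P \<inter> verts Q = {}" if "P \<in> \<P>" "Q \<in> \<P>" "P \<noteq> Q" for P Q
    using assms that unfolding path_cover_def pairwise_def by blast
  have un: "\<Union> (verts ` \<P>) = verts G" using assms(2) by (simp add: path_cover_def)
  have "\<forall>P\<in>\<P>. \<exists>xs. path_order P xs" using ind(2) by blast
  from bchoice[OF this] obtain f where f: "\<forall>P\<in>\<P>. path_order P (f P)" by (rule exE)
  have sf: "verts P = set (f P)" "f P \<noteq> []" if "P \<in> \<P>" for P
    using bspec[OF f that] by (simp_all add: path_order_def)
  have inj: "inj_on f \<P>"
  proof (rule inj_onI, rule ccontr)
    fix P Q assume *: "P \<in> \<P>" "Q \<in> \<P>" "f P = f Q" "P \<noteq> Q"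
    then have "set (f P) = {}" using disj[of P Q] sf[of P] sf[of Q] by simp
    then show False using sf(2)[OF *(1)] by simp
  qed
  \<comment> \<open>\<open>path_cover\<close> does not state finiteness; it follows because the
    paths have distinct vertex sets inside \<open>verts G\<close>.\<close>
  have "finite (verts ` \<P>)"
    by (rule finite_subset[of _ "Pow (verts G)"]) (use un assms(1) in auto)
  moreover have "inj_on verts \<P>"
  proof (rule inj_onI, rule ccontr)
    fix P Q assume *: "P \<in> \<P>" "Q \<in> \<P>" "verts P = verts Q" "P \<noteq> Q"
    then have "set (f P) = {}" using disj[of P Q] sf[of P] by simp
    then show False using sf(2)[OF *(1)] by simp
  qed
  ultimately have fin: "finite \<P>" by (rule finite_imageD)
  have "induced_list_cover (adj G) (verts G) (f ` \<P>)"
    unfolding induced_list_cover_def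
  proof (intro conjI ballI impI)
    show "finite (f ` \<P>)" using fin by simp
    show "induced_list (adj G) xs" if "xs \<in> f ` \<P>" for xs
      using that path_order_induced_list ind(1) f by blast
    show "set xs \<inter> set ys = {}" if xy: "xs \<in> f ` \<P>" "ys \<in> f ` \<P>" "xs \<noteq> ys" for xs ys
    proof -
      obtain P Q where "P \<in> \<P>" "Q \<in> \<P>" "xs = f P" "ys = f Q" using xy(1,2) by blast
      then show ?thesis using disj[of P Q] sf(1)[of P] sf(1)[of Q] xy(3) by auto
    qed
    show "\<Union> (set ` f ` \<P>) = verts G" unfolding un[symmetric] using sf(1) by auto
  qed
  then show thesis using that f inj by blast
qed

lemma induced_list_cover_path_cover:
  assumes "wf_digraph G" "induced_list_cover (adj G) (verts G) L"
  shows "path_cover G ((\<lambda>xs. G \<restriction> set xs) ` L)" "card ((\<lambda>xs. G \<restriction> set xs) ` L) = card L"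
proof -
  have ind: "induced_list (adj G) xs" "set xs \<subseteq> verts G" if "xs \<in> L" for xs
    using assms(2) that unfolding induced_list_cover_def by blast+
  have disj: "set xs \<inter> set ys = {}" if "xs \<in> L" "ys \<in> L" "xs \<noteq> ys" for xs ys
    using assms(2) that unfolding induced_list_cover_def by blast
  show "path_cover G ((\<lambda>xs. G \<restriction> set xs) ` L)"
    unfolding path_cover_def
  proof (intro conjI ballI)
    fix P assume "P \<in> (\<lambda>xs. G \<restriction> set xs) ` L"
    then obtain xs where xs: "xs \<in> L" "P = G \<restriction> set xs" by blast
    show "induced_path P G"
      unfolding induced_path_def xs(2)
      using wf_digraph.induced_induce[OF assms(1) ind(2)[OF xs(1)]]
        induced_list_path_order[OF ind(1)[OF xs(1)]] by (intro conjI exI)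
  next
    show "pairwise (\<lambda>P Q. verts P \<inter> verts Q = {}) ((\<lambda>xs. G \<restriction> set xs) ` L)"
      unfolding pairwise_def using disj by fastforce
    show "(\<Union>P\<in>(\<lambda>xs. G \<restriction> set xs) ` L. verts P) = verts G"
      using assms(2) by (simp add: induced_list_cover_def)
  qed
  show "card ((\<lambda>xs. G \<restriction> set xs) ` L) = card L"
  proof (rule card_image, rule inj_onI, rule ccontr)
    fix xs ys assume *: "xs \<in> L" "ys \<in> L" "G \<restriction> set xs = G \<restriction> set ys" "xs \<noteq> ys"
    then have "verts (G \<restriction> set xs) = verts (G \<restriction> set ys)" by simp
    then have "set xs = {}" using disj[OF *(1,2,4)] by simp
    then show False using ind(1)[OF *(1)] by (simp add: induced_list_def)
  qed
qed

lemma path_cover_of_zero_forcing_set: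
  assumes "graph G" "zero_forcing_set G Z"
  obtains \<P> where "path_cover G \<P>" "card \<P> = card Z"
proof -
  interpret graph G by fact
  have "symp (adj G)" using sym_arcs by (auto simp: symmetric_def sym_def symp_def)
  moreover have "\<not> adj G x x" for x using adj_not_same by blast
  moreover have "finite Z" "(colour_change G)\<^sup>*\<^sup>* Z (verts G)"
    using assms(2) finite_subset[of Z "verts G"] by (simp_all add: zero_forcing_set_def)
  ultimately obtain L where "induced_list_cover (adj G) (verts G) L" "card L = card Z"
    using black_set_chains[of G Z "verts G"] by blast
  then show thesis using that induced_list_cover_path_cover[OF wf_digraph] by metis
qed

lemma chronological_list_run:
  "chronological_list G B fs \<Longrightarrow> (colour_change G)\<^sup>*\<^sup>* B (verts G)"
proof (induction fs arbitrary: B)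
  case (Cons f fs)
  obtain u v where f: "f = (u, v)" by (cases f)
  then have "colour_change G B (insert v B)" using Cons.prems by (auto simp: colour_change_def)
  moreover have "(colour_change G)\<^sup>*\<^sup>* (insert v B) (verts G)" using Cons f by simp
  ultimately show ?case by (rule converse_rtranclp_into_rtranclp)
qed simp

lemma path_cover_forcing:
  assumes "graph G" "block_cycle_graph G" "path_cover G \<P>"
  obtains e fs where "\<And>P. P \<in> \<P> \<Longrightarrow> end_point P (e P)" "chronological_list G (e ` \<P>) fs"
    "chains_are_paths G fs \<P>" "zero_forcing_set G (e ` \<P>)" "card (e ` \<P>) = card \<P>"
proof -
  interpret graph G by fact
  interpret block_cycle "adj G" "verts G" by (rule block_cycle_graph_is_block_cycle) fact
  obtain f where f: "\<And>P. P \<in> \<P> \<Longrightarrow> path_order P (f P)" "inj_on f \<P>"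
    and cov: "induced_list_cover (adj G) (verts G) (f ` \<P>)"
    by (rule path_cover_lists[OF finite_verts assms(3)]) blast
  obtain \<sigma> where no: "\<And>D u. D \<subseteq> orient \<sigma> ` f ` \<P> \<Longrightarrow> \<not> deadlock (adj G) (\<lambda>_. True) D u"
    by (rule oriented_cover_exists[OF cov]) blast
  let ?L = "orient \<sigma> ` f ` \<P>"
  define g where "g P = orient \<sigma> (f P)" for P
  \<comment> \<open>The chosen end-point is the head of the oriented list, the vertex of the path
    that is black at the start.\<close>
  define e where "e P = hd (g P)" for P
  have L: "?L = g ` \<P>" by (simp add: g_def image_image)
  have covL: "induced_list_cover (adj G) (verts G) (g ` \<P>)"
    using induced_list_cover_orient[OF cov, of \<sigma>] unfolding L .
  obtain fs where fs: "chronological_list G (hd ` g ` \<P>) fs"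
    "\<And>x y. (x, y) \<in> set fs \<longleftrightarrow> (\<exists>xs\<in>g ` \<P>. next_in xs x y)"
    using forcing_run_from_heads[OF covL] no unfolding L by blast
  have "hd ` g ` \<P> = e ` \<P>" by (simp add: e_def image_image)
  then have run: "chronological_list G (e ` \<P>) fs" using fs(1) by simp
  have pg: "path_order P (g P)" if "P \<in> \<P>" for P
    using f(1)[OF that] by (simp add: g_def orient_def path_order_rev)
  have ends: "end_point P (e P)" if "P \<in> \<P>" for P
    unfolding end_point_def e_def using pg[OF that] by blast
  have eP: "e P \<in> verts P" if "P \<in> \<P>" for P
    using pg[OF that] by (simp add: e_def path_order_def)
  have "chains_are_paths G fs \<P>"
    unfolding chains_are_paths_def maximal_chains[OF covL fs(2)] using pg by blast
  moreover have "zero_forcing_set G (e ` \<P>)"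
  proof -
    have "e ` \<P> \<subseteq> verts G" using eP assms(3) by (auto simp: path_cover_def)
    then show ?thesis using chronological_list_run[OF run] by (simp add: zero_forcing_set_def)
  qed
  moreover have "card (e ` \<P>) = card \<P>"
  proof (rule card_image, rule inj_onI, rule ccontr)
    fix P Q assume *: "P \<in> \<P>" "Q \<in> \<P>" "e P = e Q" "P \<noteq> Q"
    then have "verts P \<inter> verts Q = {}"
      using assms(3) unfolding path_cover_def pairwise_def by blast
    then show False using eP[of P] eP[of Q] * by auto
  qed
  ultimately show thesis using that ends run by blast
qed

theorem theorem4p17:
  fixes G :: "('a, 'b) pre_digraph"
  assumes "graph G"
    and "block_cycle_graph G"
  shows "zero_forcing_number G = path_cover_number G \<and>
    (\<forall>\<P>. path_cover G \<P> \<and> card \<P> = path_cover_number G \<longrightarrow>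
       (\<exists>e. (\<forall>P\<in>\<P>. end_point P (e P)) \<and>
            minimum_zero_forcing_set G (e ` \<P>) \<and>
            (\<exists>fs. chronological_list G (e ` \<P>) fs \<and> chains_are_paths G fs \<P>)))"
proof -
  let ?Z = "\<lambda>k. \<exists>Z. zero_forcing_set G Z \<and> card Z = k"
  let ?C = "\<lambda>k. \<exists>\<P>. path_cover G \<P> \<and> card \<P> = k"
  have "?Z = ?C"
  proof (intro ext iffI)
    show "?C k" if "?Z k" for k
      using that path_cover_of_zero_forcing_set[OF assms(1)] by metis
    show "?Z k" if "?C k" for k
      using that path_cover_forcing[OF assms] by metis
  qed
  then have eq: "zero_forcing_number G = path_cover_number G"
    by (simp add: zero_forcing_number_def path_cover_number_def)
  moreover have "\<exists>e. (\<forall>P\<in>\<P>. end_point P (e P)) \<and> minimum_zero_forcing_set G (e ` \<P>) \<and>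
      (\<exists>fs. chronological_list G (e ` \<P>) fs \<and> chains_are_paths G fs \<P>)"
    if "path_cover G \<P>" "card \<P> = path_cover_number G" for \<P>
    using path_cover_forcing[OF assms that(1)] that(2) eq unfolding minimum_zero_forcing_set_def by metis
  ultimately show ?thesis by blast
qed

end
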